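(* The quantum algebra $U_q(\mathfrak g_{\bar 0})$ is isomorphic, as an $\mathbb F(q)$-algebra, to its canonical image $\dot U_q(\mathfrak g_{\bar 0})$ in $U_q(\mathfrak g)$, $\mathfrak g=\mathfrak{gl}(m,n)$.
   Context: Let $m,n\ge1$, $\mathbb F$ a field of characteristic $0$, $q$ an indeterminate, $q_i=q$ for $i\le m$ and $q_i=q^{-1}$ for $i>m$. $U_q=U_q(\mathfrak g)$ is the associative unital $\mathbb F(q)$-superalgebra with generators $E_{i,i+1},F_{i,i+1}$ ($1\le i<m+n$), $K_j^{\pm1}$ ($1\le j\le m+n$), where $E_{m,m+1},F_{m,m+1}$ are odd and all other generators even, and relations (with $[x,y]=xy-(-1)^{\bar x\bar y}yx$; relations with out-of-range indices are omitted) (R1) $K_iK_j=K_jK_i$, $K_iK_i^{-1}=K_i^{-1}K_i=1$; (R2) $K_iE_{j,j+1}K_i^{-1}=q_i^{\delta_{ij}-\delta_{i,j+1}}E_{j,j+1}$, $K_iF_{j,j+1}K_i^{-1}=q_i^{-(\delta_{ij}-\delta_{i,j+1})}F_{j,j+1}$; (R3) $[E_{i,i+1},F_{j,j+1}]=\delta_{ij}\dfrac{K_iK_{i+1}^{-1}-K_i^{-1}K_{i+1}}{q_i-q_i^{-1}}$; (R4) $E_{m,m+1}^2=F_{m,m+1}^2=0$; (R5) $E_{i,i+1}E_{j,j+1}=E_{j,j+1}E_{i,i+1}$, $F_{i,i+1}F_{j,j+1}=F_{j,j+1}F_{i,i+1}$ if $|i-j|>1$; (R6) $E_{i,i+1}^2E_{j,j+1}-(q+q^{-1})E_{i,i+1}E_{j,j+1}E_{i,i+1}+E_{j,j+1}E_{i,i+1}^2=0$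 if $|i-j|=1$, $i\ne m$; (R7) the same as (R6) with $F$ in place of $E$; (R8) $[E_{m-1,m+2},E_{m,m+1}]=[F_{m-1,m+2},F_{m,m+1}]=0$, where for $i<c<j$, $E_{ij}=E_{ic}E_{cj}-q_c^{-1}E_{cj}E_{ic}$ and $F_{ij}=-q_cF_{ic}F_{cj}+F_{cj}F_{ic}$ (independent of $c$). $U_q(\mathfrak g_{\bar0})$ is the $\mathbb F(q)$-algebra presented by the generators $E_{i,i+1},F_{i,i+1}$ ($i\ne m$), $K_j^{\pm1}$ ($1\le j\le m+n$) and those of the relations (R1)–(R3), (R5)–(R7) that involve only these generators. $\dot U_q(\mathfrak g_{\bar0})$ is the subalgebra of $U_q$ generated by $E_{i,i+1},F_{i,i+1}$ ($i\neq m$) and $K_j^{\pm1}$ ($1\le j\le m+n$), i.e. the image of the canonical homomorphism $U_q(\mathfrak g_{\bar 0})\to U_q$ sending each generator to the generator of the same name. *)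

theory Defs
  imports
    "HOL-Library.Poly_Mapping"
    "HOL-Computational_Algebra.Polynomial"
    "HOL-Computational_Algebra.Fraction_Field"
    "HOL-Algebra.QuotRing"
    "HOL-Algebra.Module"
begin

section \<open>Free associative algebras\<close>

text \<open>
  The free monoid on \<^typ>\<open>'g\<close>, written additively, so that the convolution product of
  \<^theory>\<open>HOL-Library.Poly_Mapping\<close> makes \<open>'g word \<Rightarrow>\<^sub>0 'k\<close> the free associative unital
  \<open>'k\<close>-algebra on \<^typ>\<open>'g\<close>.
\<close>

datatype 'g word = Word (letters: "'g list")

instantiation word :: (type) monoid_add
begin

definition zero_word :: "'a word" where "0 = Word []"

definition plus_word :: "'a word \<Rightarrow> 'a word \<Rightarrow> 'a word" where
  "u + v = Word (letters u @ letters v)"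

instance
  by standard (simp_all add: zero_word_def plus_word_def)

end

type_synonym ('k, 'g) free = "'g word \<Rightarrow>\<^sub>0 'k"

definition gen :: "'g \<Rightarrow> ('k::field, 'g) free" where
  "gen g = Poly_Mapping.single (Word [g]) 1"

definition scale :: "'k::field \<Rightarrow> ('k, 'g) free \<Rightarrow> ('k, 'g) free" (infixr \<open>\<cdot>\<^sub>f\<close> 75) where
  "c \<cdot>\<^sub>f x = Poly_Mapping.single 0 c * x"

text \<open>The free algebra on the subset \<open>X\<close> of the type of letters.\<close>

definition free_alg :: "'g set \<Rightarrow> ('k::field, 'g) free ring" where
  "free_alg X =
    \<lparr>carrier = {x. \<forall>w\<in>Poly_Mapping.keys x. set (letters w) \<subseteq> X},
     mult = (*), one = 1, zero = 0, add = (+)\<rparr>"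


section \<open>Presented algebras, generated subalgebras, isomorphisms\<close>

text \<open>
  A \<open>'k\<close>-algebra is represented by a \<^typ>\<open>('k, 'a) module\<close> record, which extends the ring record
  by a scalar multiplication; here the scalars are all elements of the field type \<open>'k\<close>. The
  locale \<^locale>\<open>algebra\<close> of \<^theory>\<open>HOL-Algebra.Module\<close> is for commutative algebras only and is not
  used. Note that \<^const>\<open>genideal\<close> generates two-sided ideals.
\<close>

definition presented_alg :: "'g set \<Rightarrow> ('k::field, 'g) free set \<Rightarrow> ('k, ('k, 'g) free set) module"
  where
  "presented_alg X R =
    (let A = free_alg X; I = Idl\<^bsub>A\<^esub> R; Q = A Quot I in
      \<lparr>carrier = carrier Q, mult = mult Q, one = one Q, zero = zero Q, add = add Q,
       smult = (\<lambda>c C. \<Union>x\<in>C. I +>\<^bsub>A\<^esub> (c \<cdot>\<^sub>f x))\<rparr>)"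

definition presented_gen :: "'g set \<Rightarrow> ('k::field, 'g) free set \<Rightarrow> 'g \<Rightarrow> ('k, 'g) free set" where
  "presented_gen X R g = Idl\<^bsub>free_alg X\<^esub> R +>\<^bsub>free_alg X\<^esub> gen g"

inductive_set alg_span :: "('k, 'a) module \<Rightarrow> 'a set \<Rightarrow> 'a set"
  for A :: "('k, 'a) module" and S :: "'a set" where
  incl: "x \<in> S \<Longrightarrow> x \<in> alg_span A S"
| one: "\<one>\<^bsub>A\<^esub> \<in> alg_span A S"
| zero: "\<zero>\<^bsub>A\<^esub> \<in> alg_span A S"
| add: "x \<in> alg_span A S \<Longrightarrow> y \<in> alg_span A S \<Longrightarrow> x \<oplus>\<^bsub>A\<^esub> y \<in> alg_span A S"
| mult: "x \<in> alg_span A S \<Longrightarrow> y \<in> alg_span A S \<Longrightarrow> x \<otimes>\<^bsub>A\<^esub> y \<in> alg_span A S"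
| smult: "x \<in> alg_span A S \<Longrightarrow> c \<odot>\<^bsub>A\<^esub> x \<in> alg_span A S"

definition generated_subalg :: "('k, 'a) module \<Rightarrow> 'a set \<Rightarrow> ('k, 'a) module" where
  "generated_subalg A S = A\<lparr>carrier := alg_span A S\<rparr>"

definition alg_iso :: "('k, 'a) module \<Rightarrow> ('k, 'b) module \<Rightarrow> ('a \<Rightarrow> 'b) set" where
  "alg_iso A B =
    {h \<in> ring_iso A B. \<forall>c. \<forall>x\<in>carrier A. h (c \<odot>\<^bsub>A\<^esub> x) = c \<odot>\<^bsub>B\<^esub> h x}"


section \<open>The quantum superalgebra of type gl(m,n)\<close>

text \<open>
  \<open>gE i\<close> and \<open>gF i\<close> name the generators $E_{i,i+1}$ and $F_{i,i+1}$, while \<open>gK j\<close> and \<open>gKinv j\<close>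
  name $K_j$ and $K_j^{-1}$. The ground field \<open>\<F>(q)\<close> is \<^typ>\<open>'f poly fract\<close>.
\<close>

datatype qgen = gE nat | gF nat | gK nat | gKinv nat

type_synonym 'f qfree = "('f poly fract, qgen) free"

abbreviation E :: "nat \<Rightarrow> 'f::field_char_0 qfree" where "E i \<equiv> gen (gE i)"
abbreviation F :: "nat \<Rightarrow> 'f::field_char_0 qfree" where "F i \<equiv> gen (gF i)"
abbreviation K :: "nat \<Rightarrow> 'f::field_char_0 qfree" where "K i \<equiv> gen (gK i)"
abbreviation Kinv :: "nat \<Rightarrow> 'f::field_char_0 qfree" where "Kinv i \<equiv> gen (gKinv i)"

definition q :: "'f::field_char_0 poly fract" where
  "q = Fract [:0, 1:] 1"

definition qi :: "nat \<Rightarrow> nat \<Rightarrow> 'f::field_char_0 poly fract" where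
  "qi m i = (if i \<le> m then q else inverse q)"

definition qgens :: "nat \<Rightarrow> nat \<Rightarrow> qgen set" where
  "qgens m n = gE ` {1..<m+n} \<union> gF ` {1..<m+n} \<union> gK ` {1..m+n} \<union> gKinv ` {1..m+n}"

fun odd_gen :: "nat \<Rightarrow> qgen \<Rightarrow> bool" where
  "odd_gen m (gE i) = (i = m)"
| "odd_gen m (gF i) = (i = m)"
| "odd_gen m (gK i) = False"
| "odd_gen m (gKinv i) = False"

definition even_qgens :: "nat \<Rightarrow> nat \<Rightarrow> qgen set" where
  "even_qgens m n = {g \<in> qgens m n. \<not> odd_gen m g}"

text \<open>
  The free algebra is graded modulo 2 by the number of odd letters of a word. The super
  commutator is used for homogeneous arguments only.
\<close>

definition odd_elem :: "nat \<Rightarrow> 'f::field_char_0 qfree \<Rightarrow> bool" where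
  "odd_elem m x \<longleftrightarrow>
    (\<forall>w\<in>Poly_Mapping.keys x. odd (length (filter (odd_gen m) (letters w))))"

definition super_comm :: "nat \<Rightarrow> 'f::field_char_0 qfree \<Rightarrow> 'f qfree \<Rightarrow> 'f qfree" where
  "super_comm m x y = (if odd_elem m x \<and> odd_elem m y then x * y + y * x else x * y - y * x)"

text \<open>
  \<open>Eroot m i j\<close> and \<open>Froot m i j\<close> are $E_{ij}$ and $F_{ij}$ for \<open>i < j\<close>, expanded with \<open>c = j - 1\<close> at
  every step. In the free algebra a choice of \<open>c\<close> is needed; other choices give the same element
  modulo the relations \<open>R5\<close>.
\<close>

fun Eroot :: "nat \<Rightarrow> nat \<Rightarrow> nat \<Rightarrow> 'f::field_char_0 qfree" where
  "Eroot m i 0 = 0"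
| "Eroot m i (Suc c) =
    (if c = i then E i
     else Eroot m i c * E c - inverse (qi m c) \<cdot>\<^sub>f (E c * Eroot m i c))"

fun Froot :: "nat \<Rightarrow> nat \<Rightarrow> nat \<Rightarrow> 'f::field_char_0 qfree" where
  "Froot m i 0 = 0"
| "Froot m i (Suc c) =
    (if c = i then F i
     else - (qi m c \<cdot>\<^sub>f (Froot m i c * F c)) + F c * Froot m i c)"

text \<open>A relation \<open>a = b\<close> is represented by the element \<open>a - b\<close> of the free algebra.\<close>

definition R1 :: "nat \<Rightarrow> nat \<Rightarrow> 'f::field_char_0 qfree set" where
  "R1 m n =
    {K i * K j - K j * K i | i j. i \<in> {1..m+n} \<and> j \<in> {1..m+n}} \<union>
    {K i * Kinv i - 1 | i. i \<in> {1..m+n}} \<union>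
    {Kinv i * K i - 1 | i. i \<in> {1..m+n}}"

definition R2 :: "nat \<Rightarrow> nat \<Rightarrow> 'f::field_char_0 qfree set" where
  "R2 m n =
    {K i * E j * Kinv i - (qi m i powi (of_bool (i = j) - of_bool (i = j + 1))) \<cdot>\<^sub>f E j
      | i j. i \<in> {1..m+n} \<and> j \<in> {1..<m+n}} \<union>
    {K i * F j * Kinv i - (qi m i powi (- (of_bool (i = j) - of_bool (i = j + 1)))) \<cdot>\<^sub>f F j
      | i j. i \<in> {1..m+n} \<and> j \<in> {1..<m+n}}"

definition R3 :: "nat \<Rightarrow> nat \<Rightarrow> 'f::field_char_0 qfree set" where
  "R3 m n =
    {super_comm m (E i) (F j) -
       (of_bool (i = j) / (qi m i - inverse (qi m i))) \<cdot>\<^sub>f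
         (K i * Kinv (i + 1) - Kinv i * K (i + 1))
      | i j. i \<in> {1..<m+n} \<and> j \<in> {1..<m+n}}"

definition R4 :: "nat \<Rightarrow> 'f::field_char_0 qfree set" where
  "R4 m = {E m * E m, F m * F m}"

definition R5 :: "nat \<Rightarrow> nat \<Rightarrow> 'f::field_char_0 qfree set" where
  "R5 m n =
    {E i * E j - E j * E i
      | i j. i \<in> {1..<m+n} \<and> j \<in> {1..<m+n} \<and> \<bar>int i - int j\<bar> > 1} \<union>
    {F i * F j - F j * F i
      | i j. i \<in> {1..<m+n} \<and> j \<in> {1..<m+n} \<and> \<bar>int i - int j\<bar> > 1}"

definition R6 :: "nat \<Rightarrow> nat \<Rightarrow> 'f::field_char_0 qfree set" where
  "R6 m n =
    {E i * E i * E j - (q + inverse q) \<cdot>\<^sub>f (E i * E j * E i) + E j * E i * E i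
      | i j. i \<in> {1..<m+n} \<and> j \<in> {1..<m+n} \<and> \<bar>int i - int j\<bar> = 1 \<and> i \<noteq> m}"

definition R7 :: "nat \<Rightarrow> nat \<Rightarrow> 'f::field_char_0 qfree set" where
  "R7 m n =
    {F i * F i * F j - (q + inverse q) \<cdot>\<^sub>f (F i * F j * F i) + F j * F i * F i
      | i j. i \<in> {1..<m+n} \<and> j \<in> {1..<m+n} \<and> \<bar>int i - int j\<bar> = 1 \<and> i \<noteq> m}"

text \<open>The indices \<open>m - 1\<close> and \<open>m + 2\<close> are in range exactly if \<open>m, n \<ge> 2\<close>.\<close>

definition R8 :: "nat \<Rightarrow> nat \<Rightarrow> 'f::field_char_0 qfree set" where
  "R8 m n =
    (if m \<ge> 2 \<and> n \<ge> 2 then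
       {super_comm m (Eroot m (m - 1) (m + 2)) (E m),
        super_comm m (Froot m (m - 1) (m + 2)) (F m)}
     else {})"

definition Uq_rels :: "nat \<Rightarrow> nat \<Rightarrow> 'f::field_char_0 qfree set" where
  "Uq_rels m n =
    R1 m n \<union> R2 m n \<union> R3 m n \<union> R4 m \<union> R5 m n \<union> R6 m n \<union> R7 m n \<union> R8 m n"

text \<open>The relations among \<open>R1\<close>-\<open>R3\<close> and \<open>R5\<close>-\<open>R7\<close> that involve even generators only.\<close>

definition Uq0_rels :: "nat \<Rightarrow> nat \<Rightarrow> 'f::field_char_0 qfree set" where
  "Uq0_rels m n =
    (R1 m n \<union> R2 m n \<union> R3 m n \<union> R5 m n \<union> R6 m n \<union> R7 m n) \<inter>
      carrier (free_alg (even_qgens m n))"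

type_synonym 'f qalg = "('f poly fract, 'f qfree set) module"

definition Uq :: "nat \<Rightarrow> nat \<Rightarrow> 'f::field_char_0 qalg" where
  "Uq m n = presented_alg (qgens m n) (Uq_rels m n)"

definition Uq_gen :: "nat \<Rightarrow> nat \<Rightarrow> qgen \<Rightarrow> 'f::field_char_0 qfree set" where
  "Uq_gen m n = presented_gen (qgens m n) (Uq_rels m n)"

definition Uq0 :: "nat \<Rightarrow> nat \<Rightarrow> 'f::field_char_0 qalg" where
  "Uq0 m n = presented_alg (even_qgens m n) (Uq0_rels m n)"

definition Uq0_gen :: "nat \<Rightarrow> nat \<Rightarrow> qgen \<Rightarrow> 'f::field_char_0 qfree set" where
  "Uq0_gen m n = presented_gen (even_qgens m n) (Uq0_rels m n)"

definition Uq0_dot :: "nat \<Rightarrow> nat \<Rightarrow> 'f::field_char_0 qalg" where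
  "Uq0_dot m n = generated_subalg (Uq m n) (Uq_gen m n ` even_qgens m n)"

end

(* The canonical homomorphism is injective because the even subalgebra acts faithfully on an induced
   module. Let T be the free algebra on symbols F_1, F_2, ..., J the ideal of T generated by the Serre
   elements (including F_m^2 and the quartic relation R8), and let U_0 be the even algebra. On the
   tensor product of T/J and U_0 the generators F_j act by left multiplication, K_j diagonally, and
   E_i by
     f (x) a |-> s(f) (x) E_i a + (D'(f) (x) k_i a - D(f) (x) k_i^-1 a) / (q_i - q_i^-1),
   where E_m a is replaced by 0, k_i = K_i K_(i+1)^-1, s is the parity twist, and D, D' are the two
   skew derivations attached to i; this is the module induced from the Borel subalgebra. One explicit
   computation, that skew derivations preserve J, shows both that the operators are well defined and
   that the Serre elements in the E_i commute with all F_j up to elements of the same ideal, hence act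
   by zero. The map f (x) a |-> pi(f) a with pi(F_m) = 0 is U_0-linear, so the element x of U_0 is
   recovered from its action on 1 (x) 1. Quotients are avoided by computing in free algebras modulo
   ideals. *)
theory Submission
  imports Defs
begin

section \<open>Additive maps and congruences\<close>

text \<open>Killing E_m and F_m does not define a retraction of U_q(g) onto the even algebra: (R3)
  for i = j = m would force K_m^2 = K_(m+1)^2. The relations among the E and K alone, and those
  among the F and K alone, do survive this substitution. The first fact makes the even algebra a
  module over the Borel subalgebra, which can then be induced; the second makes the final projection
  well defined. On the induced module the relations among the F letters hold by construction, so the
  relations among the E letters are the real obstacle. On vectors 1 (x) a an element of J acts
  through its image under E_m -> 0, which is a consequence of the even relations; this starts an
  induction on the F word. The induction concerns the whole ideal J and not single Serre elements,
  because the quartic element of (R8) is carried by skew derivations into the ideal without being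
  annihilated.\<close>

lemma poly_mapping_additive_induct [case_names single add]:
  fixes f :: "'b \<Rightarrow>\<^sub>0 'c::comm_monoid_add"
  assumes "\<And>w c. P (Poly_Mapping.single w c)"
    and "\<And>x y. P x \<Longrightarrow> P y \<Longrightarrow> P (x + y)"
  shows "P f"
proof (induction f rule: update_induct)
  case const
  have "P (Poly_Mapping.single undefined 0)" by (rule assms(1))
  then show ?case by simp
next
  case (update f a b)
  have "Poly_Mapping.update a b f = f + Poly_Mapping.single a b"
    using update(1) by (intro poly_mapping_eqI)
      (auto simp: update.rep_eq lookup_add lookup_single in_keys_iff when_def)
  then show ?case using assms update by simp
qed

text \<open>The values \<open>h w\<close> only have to be additive in the coefficient: coefficients
  are scalars for \<open>lift\<close> and \<open>act\<close>, but elements of a noncommutative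
  algebra for \<open>tensor_op\<close> and \<open>contract\<close>.\<close>

definition additive_ext :: "('b \<Rightarrow> 'c::ab_group_add \<Rightarrow> 'v::ab_group_add) \<Rightarrow> ('b \<Rightarrow>\<^sub>0 'c) \<Rightarrow> 'v" where
  "additive_ext h f = (\<Sum>w\<in>Poly_Mapping.keys f. h w (Poly_Mapping.lookup f w))"

lemma additive_ext_superset:
  assumes "\<And>w. additive (h w)" and "finite S" and "Poly_Mapping.keys f \<subseteq> S"
  shows "additive_ext h f = (\<Sum>w\<in>S. h w (Poly_Mapping.lookup f w))"
  unfolding additive_ext_def using assms
  by (intro sum.mono_neutral_left) (auto simp: in_keys_iff additive.zero)

lemma additive_additive_ext:
  assumes "\<And>w. additive (h w)"
  shows "additive (additive_ext h)"
proof
  fix x y :: "'a \<Rightarrow>\<^sub>0 'b"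
  let ?S = "Poly_Mapping.keys x \<union> Poly_Mapping.keys y"
  have "Poly_Mapping.keys (x + y) \<subseteq> ?S" by (rule keys_add)
  then show "additive_ext h (x + y) = additive_ext h x + additive_ext h y"
    using additive_ext_superset[OF assms, of ?S x] additive_ext_superset[OF assms, of ?S y]
      additive_ext_superset[OF assms, of ?S "x + y"]
    by (simp add: lookup_add additive.add[OF assms] sum.distrib)
qed

lemma additive_ext_single:
  assumes "\<And>w. additive (h w)"
  shows "additive_ext h (Poly_Mapping.single w c) = h w c"
  using additive.zero[OF assms] by (simp add: additive_ext_def)

lemma additive_ext_single_id: "additive_ext Poly_Mapping.single f = f"
proof -
  have *: "additive (Poly_Mapping.single w)" for w :: 'a by standard (rule single_add)
  show ?thesis
    by (induction f rule: poly_mapping_additive_induct)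
      (simp_all add: additive_ext_single[OF *] additive.add[OF additive_additive_ext[OF *]])
qed

text \<open>Only the group operations are built in. Ideals arise from \<open>multiples\<close>, a
  set already closed under multiplication, so that an additive map needs checking on generators
  only.\<close>

inductive_set additive_span :: "'v::ab_group_add set \<Rightarrow> 'v set" for S where
  base: "x \<in> S \<Longrightarrow> x \<in> additive_span S"
| zero: "0 \<in> additive_span S"
| add: "x \<in> additive_span S \<Longrightarrow> y \<in> additive_span S \<Longrightarrow> x + y \<in> additive_span S"
| minus: "x \<in> additive_span S \<Longrightarrow> - x \<in> additive_span S"

lemma additive_span_diff:
  "x \<in> additive_span S \<Longrightarrow> y \<in> additive_span S \<Longrightarrow> x - y \<in> additive_span S"
  using additive_span.add[OF _ additive_span.minus] by fastforce

lemma additive_span_image: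
  assumes "additive h" and "\<And>x. x \<in> S \<Longrightarrow> h x \<in> additive_span S'" and "x \<in> additive_span S"
  shows "h x \<in> additive_span S'"
  using assms(3)
  by induction (auto simp: assms(2) additive.zero[OF assms(1)] additive.add[OF assms(1)]
      additive.minus[OF assms(1)] intro: additive_span.intros)

definition cong_span :: "'v::ab_group_add set \<Rightarrow> 'v \<Rightarrow> 'v \<Rightarrow> bool" where
  "cong_span S x y \<longleftrightarrow> x - y \<in> additive_span S"

lemma cong_span_refl [simp, intro]: "cong_span S x x"
  by (simp add: cong_span_def additive_span.zero)

lemma cong_span_sym: "cong_span S x y \<Longrightarrow> cong_span S y x"
  using additive_span.minus[of "x - y"] by (simp add: cong_span_def)

lemma cong_span_trans [trans]: "cong_span S x y \<Longrightarrow> cong_span S y z \<Longrightarrow> cong_span S x z"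
  using additive_span.add[of "x - y" S "y - z"] by (simp add: cong_span_def)

lemma cong_span_add: "cong_span S x y \<Longrightarrow> cong_span S x' y' \<Longrightarrow> cong_span S (x + x') (y + y')"
  using additive_span.add[of "x - y" S "x' - y'"] by (simp add: cong_span_def algebra_simps)

lemma cong_span_minus: "cong_span S x y \<Longrightarrow> cong_span S (- x) (- y)"
  using additive_span.minus[of "x - y"] by (simp add: cong_span_def)

lemma cong_span_diff: "cong_span S x y \<Longrightarrow> cong_span S x' y' \<Longrightarrow> cong_span S (x - x') (y - y')"
  using cong_span_add[OF _ cong_span_minus] by fastforce

lemma cong_span_0: "cong_span S x 0 \<longleftrightarrow> x \<in> additive_span S"
  by (simp add: cong_span_def)

lemma cong_span_mem: "cong_span S x y \<Longrightarrow> y \<in> additive_span S \<Longrightarrow> x \<in> additive_span S"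
  using cong_span_0 cong_span_trans by blast

lemma cong_span_map:
  assumes "additive h" and "\<And>x. x \<in> additive_span S \<Longrightarrow> h x \<in> additive_span S'" and "cong_span S x y"
  shows "cong_span S' (h x) (h y)"
  using assms by (simp add: cong_span_def additive.diff[OF assms(1), symmetric])

section \<open>Two-sided ideals of a ring\<close>

definition multiples :: "'r::ring_1 set \<Rightarrow> 'r set" where
  "multiples R = {a * r * b | a r b. r \<in> R}"

abbreviation ideal_span :: "'r::ring_1 set \<Rightarrow> 'r set" where
  "ideal_span R \<equiv> additive_span (multiples R)"

abbreviation cong_ideal :: "'r::ring_1 set \<Rightarrow> 'r \<Rightarrow> 'r \<Rightarrow> bool" where
  "cong_ideal R \<equiv> cong_span (multiples R)"

lemma additive_mult_left: "additive ((*) (a :: 'r::ring))"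
  by standard (rule distrib_left)

lemma additive_mult_right: "additive (\<lambda>x. x * (a :: 'r::ring))"
  by standard (rule distrib_right)

lemma ideal_span_superset: "r \<in> R \<Longrightarrow> r \<in> ideal_span R"
  by (rule additive_span.base) (force simp: multiples_def intro: exI[of _ 1])

lemma multiplesI: "r \<in> R \<Longrightarrow> a * r * b \<in> multiples R"
  by (auto simp: multiples_def)

lemma multiplesE:
  assumes "x \<in> multiples R"
  obtains a r b where "r \<in> R" "x = a * r * b"
  using assms by (auto simp: multiples_def)

lemma ideal_span_mult_left: "x \<in> ideal_span R \<Longrightarrow> a * x \<in> ideal_span R"
proof (erule additive_span_image[OF additive_mult_left, rotated])
  show "a * x \<in> ideal_span R" if "x \<in> multiples R" for x
    using that by (elim multiplesE) (metis multiplesI additive_span.base mult.assoc)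
qed

lemma ideal_span_mult_right: "x \<in> ideal_span R \<Longrightarrow> x * a \<in> ideal_span R"
proof (erule additive_span_image[OF additive_mult_right, rotated])
  show "x * a \<in> ideal_span R" if "x \<in> multiples R" for x
    using that by (elim multiplesE) (metis multiplesI additive_span.base mult.assoc)
qed

lemma cong_ideal_mult:
  assumes "cong_ideal R x y" and "cong_ideal R x' y'"
  shows "cong_ideal R (x * x') (y * y')"
proof -
  have "x * x' - y * y' = (x - y) * x' + y * (x' - y')" by (simp add: algebra_simps)
  then show ?thesis using assms
    by (simp add: cong_span_def additive_span.add ideal_span_mult_left ideal_span_mult_right)
qed

lemma cong_ideal_rel: "x - y \<in> R \<Longrightarrow> cong_ideal R x y"
  by (simp add: cong_span_def ideal_span_superset)

lemma ideal_span_hom: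
  assumes "additive h" and "\<And>x y. h (x * y) = h x * h y"
    and "\<And>r. r \<in> R \<Longrightarrow> h r \<in> ideal_span R'" and "x \<in> ideal_span R"
  shows "h x \<in> ideal_span R'"
  using assms(1) _ assms(4)
proof (rule additive_span_image)
  show "h x \<in> ideal_span R'" if "x \<in> multiples R" for x
    using that
    by (elim multiplesE) (simp add: assms(2,3) ideal_span_mult_left ideal_span_mult_right)
qed

section \<open>Homomorphisms and skew derivations of free algebras\<close>

abbreviation const :: "'k \<Rightarrow> 'b::zero \<Rightarrow>\<^sub>0 'k::zero" where "const \<equiv> Poly_Mapping.single 0"

lemma single_Word_mult:
  "Poly_Mapping.single (Word u) (a :: 'k::semiring_0) * Poly_Mapping.single (Word v) b =
    Poly_Mapping.single (Word (u @ v)) (a * b)"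
  by (simp add: mult_single plus_word_def)

lemma single_Word_Nil: "Poly_Mapping.single (Word []) a = const a"
  by (simp add: zero_word_def)

lemma const_central: "const c * x = x * (const c :: 'g word \<Rightarrow>\<^sub>0 'k::comm_ring_1)"
  by (induction x rule: poly_mapping_additive_induct)
    (simp_all add: mult_single distrib_left distrib_right mult.commute)

lemma scale_single: "c \<cdot>\<^sub>f Poly_Mapping.single w a = Poly_Mapping.single w (c * a)"
  by (simp add: scale_def mult_single)

lemma scale_mult_left [simp]: "(c \<cdot>\<^sub>f x) * y = c \<cdot>\<^sub>f (x * y)"
  by (simp add: scale_def mult.assoc)

lemma scale_mult_right [simp]: "x * (c \<cdot>\<^sub>f y) = c \<cdot>\<^sub>f (x * y)"
  by (simp add: scale_def mult.assoc[symmetric] const_central[of c x])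

lemma scale_scale [simp]: "c \<cdot>\<^sub>f d \<cdot>\<^sub>f x = (c * d) \<cdot>\<^sub>f x"
  by (simp add: scale_def mult.assoc[symmetric] mult_single)

lemma scale_one [simp]: "1 \<cdot>\<^sub>f x = x"
  by (simp add: scale_def)

lemma scale_zero [simp]: "0 \<cdot>\<^sub>f x = 0" "c \<cdot>\<^sub>f 0 = 0"
  by (simp_all add: scale_def)

lemma scale_minus: "(- c) \<cdot>\<^sub>f x = - (c \<cdot>\<^sub>f x)" "c \<cdot>\<^sub>f (- x) = - (c \<cdot>\<^sub>f x)"
  by (simp_all add: scale_def single_uminus)

lemma scale_distrib: "c \<cdot>\<^sub>f (x + y) = c \<cdot>\<^sub>f x + c \<cdot>\<^sub>f y" "c \<cdot>\<^sub>f (x - y) = c \<cdot>\<^sub>f x - c \<cdot>\<^sub>f y"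
  "(c + d) \<cdot>\<^sub>f x = c \<cdot>\<^sub>f x + d \<cdot>\<^sub>f x" "(c - d) \<cdot>\<^sub>f x = c \<cdot>\<^sub>f x - d \<cdot>\<^sub>f x"
  by (simp_all add: scale_def distrib_left right_diff_distrib single_add single_diff distrib_right left_diff_distrib)

lemma cong_ideal_scale: "cong_ideal R x y \<Longrightarrow> cong_ideal R (c \<cdot>\<^sub>f x) (c \<cdot>\<^sub>f y)"
  unfolding scale_def by (intro cong_ideal_mult) auto

lemma ideal_span_scale: "x \<in> ideal_span R \<Longrightarrow> c \<cdot>\<^sub>f x \<in> ideal_span R"
  unfolding scale_def by (rule ideal_span_mult_left)

lemma single_Word_Cons: "Poly_Mapping.single (Word (l # w)) c = gen l * Poly_Mapping.single (Word w) c"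
  by (simp add: gen_def single_Word_mult)

text \<open>Fits operators known through their effect on a leading letter, such as skew derivations
  and the action on the module.\<close>

lemma free_induct [case_names const gen add]:
  assumes "\<And>c. P (const c)" and "\<And>l x. P x \<Longrightarrow> P (gen l * x)"
    and "\<And>x y. P x \<Longrightarrow> P y \<Longrightarrow> P (x + y)"
  shows "P (x :: ('k::field, 'g) free)"
proof (induction x rule: poly_mapping_additive_induct)
  case (single w c)
  have "P (Poly_Mapping.single (Word u) c)" for u
    by (induction u) (simp_all add: single_Word_Nil single_Word_Cons assms)
  then show ?case by (cases w) simp
qed (rule assms)

definition lift :: "('g \<Rightarrow> ('k::field, 'h) free) \<Rightarrow> ('k, 'g) free \<Rightarrow> ('k, 'h) free" where
  "lift h = additive_ext (\<lambda>w c. c \<cdot>\<^sub>f prod_list (map h (letters w)))"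

lemma additive_scale_right: "additive (\<lambda>c. c \<cdot>\<^sub>f x)"
  by standard (rule scale_distrib)

lemma additive_lift: "additive (lift h)"
  unfolding lift_def by (intro additive_additive_ext additive_scale_right)

lemmas lift_add = additive.add[OF additive_lift]
lemmas lift_diff = additive.diff[OF additive_lift]
lemmas lift_minus = additive.minus[OF additive_lift]
lemmas lift_zero = additive.zero[OF additive_lift]

lemma lift_single: "lift h (Poly_Mapping.single w c) = c \<cdot>\<^sub>f prod_list (map h (letters w))"
  unfolding lift_def by (rule additive_ext_single[OF additive_scale_right])

lemma lift_mult: "lift h (x * y) = lift h x * lift h y"
proof (induction x rule: poly_mapping_additive_induct)
  case (single u a)
  show ?case
    by (induction y rule: poly_mapping_additive_induct)
      (simp_all add: mult_single lift_single plus_word_def distrib_left lift_add mult.commute)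
qed (simp add: distrib_right lift_add)

lemma lift_const: "lift h (const c) = const c"
  by (simp add: lift_single zero_word_def scale_def)

lemma lift_gen: "lift h (gen l) = h l"
  by (simp add: lift_single gen_def)

lemma lift_scale: "lift h (c \<cdot>\<^sub>f x) = c \<cdot>\<^sub>f lift h x"
  by (simp add: scale_def lift_mult lift_const)

lemmas lift_simps = lift_add lift_diff lift_minus lift_zero lift_mult lift_const lift_gen lift_scale

text \<open>A diagonal endomorphism. With a character \<open>c\<close> it describes conjugation by a
  toral element; with \<open>parity\<close> it records the super sign of passing an odd
  letter.\<close>

definition twist :: "('g \<Rightarrow> 'k::field) \<Rightarrow> ('k, 'g) free \<Rightarrow> ('k, 'g) free" where
  "twist c = lift (\<lambda>j. c j \<cdot>\<^sub>f gen j)"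

lemma additive_twist: "additive (twist c)"
  unfolding twist_def by (rule additive_lift)

lemma twist_simps:
  "twist c (x + y) = twist c x + twist c y" "twist c (x - y) = twist c x - twist c y"
  "twist c (- x) = - twist c x" "twist c 0 = 0" "twist c (x * y) = twist c x * twist c y"
  "twist c (const a) = const a" "twist c (gen j) = c j \<cdot>\<^sub>f gen j" "twist c (a \<cdot>\<^sub>f x) = a \<cdot>\<^sub>f twist c x"
  by (simp_all add: twist_def lift_simps)

lemma twist_twist: "twist c (twist d x) = twist (\<lambda>j. c j * d j) x"
  by (induction x rule: free_induct) (simp_all add: twist_simps mult.commute)

lemma twist_trivial: "(\<And>j. c j = 1) \<Longrightarrow> twist c x = x"
  by (induction x rule: free_induct) (simp_all add: twist_simps)

text \<open>Origin: when E_i moves through a word of F letters, each letter passed contributes the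
  factor \<open>s j\<close>, and a letter \<open>j = i\<close> is replaced by a toral element, whose
  passage through the rest of the word twists it by \<open>c\<close>.\<close>

fun skew_word :: "('g \<Rightarrow> 'k::field) \<Rightarrow> ('g \<Rightarrow> 'k) \<Rightarrow> 'g \<Rightarrow> 'g list \<Rightarrow> ('k, 'g) free" where
  "skew_word s c i [] = 0"
| "skew_word s c i (j # w) = s j \<cdot>\<^sub>f (gen j * skew_word s c i w)
     + (if j = i then twist c (Poly_Mapping.single (Word w) 1) else 0)"

definition skew_deriv :: "('g \<Rightarrow> 'k::field) \<Rightarrow> ('g \<Rightarrow> 'k) \<Rightarrow> 'g \<Rightarrow> ('k, 'g) free \<Rightarrow> ('k, 'g) free" where
  "skew_deriv s c i = additive_ext (\<lambda>w a. a \<cdot>\<^sub>f skew_word s c i (letters w))"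

lemma additive_skew_deriv: "additive (skew_deriv s c i)"
  unfolding skew_deriv_def by (intro additive_additive_ext additive_scale_right)

lemmas skew_deriv_add = additive.add[OF additive_skew_deriv]

lemma skew_deriv_single:
  "skew_deriv s c i (Poly_Mapping.single w a) = a \<cdot>\<^sub>f skew_word s c i (letters w)"
  unfolding skew_deriv_def by (rule additive_ext_single[OF additive_scale_right])

lemma skew_deriv_const: "skew_deriv s c i (const a) = 0"
  by (simp add: skew_deriv_single zero_word_def)

lemma skew_deriv_scale: "skew_deriv s c i (a \<cdot>\<^sub>f x) = a \<cdot>\<^sub>f skew_deriv s c i x"
  by (induction x rule: poly_mapping_additive_induct)
    (simp_all add: scale_single skew_deriv_single scale_distrib skew_deriv_add)

lemma skew_deriv_gen_mult:
  "skew_deriv s c i (gen j * x) = s j \<cdot>\<^sub>f (gen j * skew_deriv s c i x) + (if j = i then twist c x else 0)"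
proof (induction x rule: poly_mapping_additive_induct)
  case (single w a)
  have "Poly_Mapping.single w a = a \<cdot>\<^sub>f Poly_Mapping.single (Word (letters w)) 1"
    by (simp add: scale_single)
  moreover have "skew_deriv s c i (gen j * Poly_Mapping.single (Word (letters w)) 1) =
      s j \<cdot>\<^sub>f (gen j * skew_deriv s c i (Poly_Mapping.single (Word (letters w)) 1))
        + (if j = i then twist c (Poly_Mapping.single (Word (letters w)) 1) else 0)"
    by (simp add: skew_deriv_single del: word.collapse flip: single_Word_Cons)
  ultimately show ?case
    by (simp only: scale_mult_right skew_deriv_scale twist_simps)
      (simp add: scale_distrib mult.commute)
qed (simp_all add: distrib_left skew_deriv_add scale_distrib twist_simps)

lemma skew_deriv_mult:
  "skew_deriv s c i (x * y) = twist s x * skew_deriv s c i y + skew_deriv s c i x * twist c y"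
proof (induction x rule: free_induct)
  case (const a)
  then show ?case by (simp add: skew_deriv_const twist_simps skew_deriv_scale flip: scale_def)
next
  case (gen l x)
  then show ?case
    by (simp add: mult.assoc skew_deriv_gen_mult twist_simps distrib_left distrib_right scale_distrib)
next
  case (add x1 x2)
  then show ?case by (simp add: distrib_left distrib_right skew_deriv_add twist_simps)
qed

lemma skew_deriv_gen: "skew_deriv s c i (gen j) = (if j = i then 1 else 0)"
  using skew_deriv_gen_mult[of s c i j "const 1"]
  using skew_deriv_const[of s c i 1] twist_simps(6)[of c 1] by simp

text \<open>The derivation removes one letter \<open>i\<close>, so the factor \<open>d i\<close>
  drops out of the weight.\<close>

lemma skew_deriv_twist:
  "skew_deriv s c i (twist d x) = d i \<cdot>\<^sub>f twist d (skew_deriv s c i x)"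
proof (induction x rule: free_induct)
  case (gen l x)
  then show ?case
    by (auto simp: skew_deriv_gen_mult skew_deriv_scale twist_simps twist_twist scale_distrib mult_ac)
qed (simp_all add: twist_simps skew_deriv_const skew_deriv_add scale_distrib)

lemmas skew_deriv_simps = skew_deriv_add additive.diff[OF additive_skew_deriv]
  additive.minus[OF additive_skew_deriv] additive.zero[OF additive_skew_deriv]
  skew_deriv_scale skew_deriv_gen skew_deriv_gen_mult

text \<open>On \<open>a * r * b\<close> the product rule leaves three terms, containing
  \<open>twist s r\<close>, \<open>skew_deriv s c i r\<close> and \<open>twist c r\<close>
  respectively.\<close>

lemma ideal_span_skew_deriv:
  assumes "\<And>r. r \<in> R \<Longrightarrow> skew_deriv s c i r \<in> ideal_span R"
    and "\<And>r. r \<in> R \<Longrightarrow> twist s r \<in> ideal_span R"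
    and "\<And>r. r \<in> R \<Longrightarrow> twist c r \<in> ideal_span R"
    and "x \<in> ideal_span R"
  shows "skew_deriv s c i x \<in> ideal_span R"
  using additive_skew_deriv _ assms(4)
proof (rule additive_span_image)
  show "skew_deriv s c i x \<in> ideal_span R" if x: "x \<in> multiples R" for x
  proof -
    obtain a r b where r: "r \<in> R" and "x = a * r * b"
      using x by (rule multiplesE)
    then show ?thesis
      using assms(1-3)[OF r] ideal_span_superset[OF r]
      by (simp add: skew_deriv_mult distrib_right twist_simps)
        (intro additive_span.add ideal_span_mult_left ideal_span_mult_right; assumption)
  qed
qed

section \<open>Presented algebras\<close>

lemma free_alg_closed:
  fixes x y :: "('k::field, 'g) free"
  shows "(gen g :: ('k, 'g) free) \<in> carrier (free_alg X) \<longleftrightarrow> g \<in> X"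
  and "(0 :: ('k, 'g) free) \<in> carrier (free_alg X)" and "(1 :: ('k, 'g) free) \<in> carrier (free_alg X)"
  and "(const c :: ('k, 'g) free) \<in> carrier (free_alg X)"
  and "x \<in> carrier (free_alg X) \<Longrightarrow> y \<in> carrier (free_alg X) \<Longrightarrow> x + y \<in> carrier (free_alg X)"
  and "x \<in> carrier (free_alg X) \<Longrightarrow> y \<in> carrier (free_alg X) \<Longrightarrow> x - y \<in> carrier (free_alg X)"
  and "x \<in> carrier (free_alg X) \<Longrightarrow> - x \<in> carrier (free_alg X)"
  and "x \<in> carrier (free_alg X) \<Longrightarrow> y \<in> carrier (free_alg X) \<Longrightarrow> x * y \<in> carrier (free_alg X)"
  and "x \<in> carrier (free_alg X) \<Longrightarrow> c \<cdot>\<^sub>f x \<in> carrier (free_alg X)"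
proof -
  show mult: "x * y \<in> carrier (free_alg X)"
    if "x \<in> carrier (free_alg X)" "y \<in> carrier (free_alg X)" for x y :: "('k, 'g) free"
    using that keys_mult[of x y] by (fastforce simp: free_alg_def plus_word_def)
  show const: "(const c :: ('k, 'g) free) \<in> carrier (free_alg X)" for c :: 'k
    by (simp add: free_alg_def zero_word_def)
  show "c \<cdot>\<^sub>f x \<in> carrier (free_alg X)" if "x \<in> carrier (free_alg X)" for x :: "('k, 'g) free"
    unfolding scale_def using that by (intro mult const)
  show "x + y \<in> carrier (free_alg X)"
    if "x \<in> carrier (free_alg X)" "y \<in> carrier (free_alg X)" for x y :: "('k, 'g) free"
    using that keys_add[of x y] by (fastforce simp: free_alg_def)
  show "x - y \<in> carrier (free_alg X)"
    if "x \<in> carrier (free_alg X)" "y \<in> carrier (free_alg X)" for x y :: "('k, 'g) free"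
    using that keys_diff[of x y] by (fastforce simp: free_alg_def)
qed (auto simp: free_alg_def gen_def zero_word_def)

lemma keys_gen: "Poly_Mapping.keys (gen g :: ('k::field, 'g) free) = {Word [g]}"
  by (simp add: gen_def)

text \<open>A retraction onto the free algebra on \<open>X\<close>. It makes elements of that
  subalgebra accessible to \<open>free_induct\<close>, which runs over all letters of the
  type.\<close>

definition restrict_gens :: "'g set \<Rightarrow> ('k::field, 'g) free \<Rightarrow> ('k, 'g) free" where
  "restrict_gens X = lift (\<lambda>g. if g \<in> X then gen g else 0)"

lemma additive_restrict_gens: "additive (restrict_gens X)"
  unfolding restrict_gens_def by (rule additive_lift)

lemma restrict_gens_simps:
  "restrict_gens X (const c) = const c"
  "restrict_gens X (gen g * x) = (if g \<in> X then gen g * restrict_gens X x else 0)"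
  "restrict_gens X (x + y) = restrict_gens X x + restrict_gens X y"
  by (simp_all add: restrict_gens_def lift_simps)

lemma restrict_gens_closed: "restrict_gens X x \<in> carrier (free_alg X)"
  by (induction x rule: free_induct) (simp_all add: restrict_gens_simps free_alg_closed)

lemma restrict_gens_id:
  fixes x :: "('k::field, 'g) free"
  assumes "x \<in> carrier (free_alg X)"
  shows "restrict_gens X x = x"
proof -
  have prod: "prod_list (map (\<lambda>g. if g \<in> X then gen g else 0) u) =
      (Poly_Mapping.single (Word u) 1 :: ('k, 'g) free)" if "set u \<subseteq> X" for u
    using that by (induction u) (simp_all add: single_Word_Cons single_Word_Nil)
  have "restrict_gens X x = additive_ext Poly_Mapping.single x"
    unfolding restrict_gens_def lift_def additive_ext_def
    using assms by (intro sum.cong refl) (simp add: free_alg_def prod scale_single)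
  also have "\<dots> = x"
    by (rule additive_ext_single_id)
  finally show ?thesis .
qed

lemma lift_closed:
  assumes "x \<in> carrier (free_alg Z)" and "\<And>z. z \<in> Z \<Longrightarrow> h z \<in> carrier (free_alg X)"
  shows "lift h x \<in> carrier (free_alg X)"
proof -
  have "lift h (restrict_gens Z x) \<in> carrier (free_alg X)"
    by (induction x rule: free_induct)
      (simp_all add: restrict_gens_simps lift_simps free_alg_closed assms(2))
  then show ?thesis using restrict_gens_id[OF assms(1)] by simp
qed

lemma free_alg_simps:
  "mult (free_alg X) = (*)" "one (free_alg X) = 1" "zero (free_alg X) = 0" "add (free_alg X) = (+)"
  by (simp_all add: free_alg_def)

lemma ring_free_alg: "ring (free_alg X :: ('k::field, 'g) free ring)"
proof (rule ringI)
  show "abelian_group (free_alg X :: ('k, 'g) free ring)"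
  proof (rule abelian_groupI)
    fix x :: "('k, 'g) free" assume "x \<in> carrier (free_alg X)"
    then have "- x \<in> carrier (free_alg X)" by (rule free_alg_closed)
    then show "\<exists>y\<in>carrier (free_alg X). y \<oplus>\<^bsub>free_alg X\<^esub> x = \<zero>\<^bsub>free_alg X\<^esub>"
      by (intro bexI[of _ "- x"]) (simp_all add: free_alg_simps)
  qed (simp_all add: free_alg_simps free_alg_closed add.assoc add.commute)
  show "monoid (free_alg X :: ('k, 'g) free ring)"
    by (rule monoidI) (simp_all add: free_alg_simps free_alg_closed mult.assoc)
qed (simp_all add: free_alg_simps distrib_left distrib_right)

lemma ideal_span_ideal:
  "ideal (ideal_span R \<inter> carrier (free_alg X)) (free_alg X :: ('k::field, 'g) free ring)"
proof (rule idealI[OF ring_free_alg])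
  let ?A = "free_alg X :: ('k, 'g) free ring"
  interpret ring ?A by (rule ring_free_alg)
  have minus: "\<ominus>\<^bsub>?A\<^esub> x = - x" if "x \<in> carrier ?A" for x
    using that by (intro minus_equality) (simp_all add: free_alg_simps free_alg_closed)
  show "subgroup (ideal_span R \<inter> carrier ?A) (add_monoid ?A)"
  proof (rule subgroup.intro)
    show "inv\<^bsub>add_monoid ?A\<^esub> x \<in> ideal_span R \<inter> carrier ?A" if "x \<in> ideal_span R \<inter> carrier ?A" for x
      unfolding a_inv_def[symmetric] using that by (simp add: minus free_alg_closed additive_span.minus)
  qed (auto simp: free_alg_simps free_alg_closed additive_span.intros)
qed (auto simp: free_alg_simps free_alg_closed ideal_span_mult_left ideal_span_mult_right)

text \<open>\<open>ideal_span\<close> allows multipliers with letters outside \<open>X\<close>.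
  Applying \<open>restrict_gens X\<close> to \<open>a * r * b\<close> fixes the relation
  \<open>r\<close> and moves the multipliers into the subalgebra, so no new elements of the
  subalgebra arise.\<close>

lemma genideal_free_alg:
  fixes R :: "('k::field, 'g) free set"
  assumes "R \<subseteq> carrier (free_alg X)"
  shows "Idl\<^bsub>free_alg X\<^esub> R = ideal_span R \<inter> carrier (free_alg X)"
proof
  let ?A = "free_alg X :: ('k, 'g) free ring"
  interpret ring ?A by (rule ring_free_alg)
  show "Idl\<^bsub>?A\<^esub> R \<subseteq> ideal_span R \<inter> carrier ?A"
    using assms by (intro genideal_minimal[OF ideal_span_ideal]) (auto intro: ideal_span_superset)
  interpret I: ideal "Idl\<^bsub>?A\<^esub> R" ?A by (rule genideal_ideal[OF assms])
  have "restrict_gens X x \<in> Idl\<^bsub>?A\<^esub> R" if "x \<in> ideal_span R" for x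
    using that
  proof induction
    case (base x)
    then obtain a r b where r: "r \<in> R" and x: "x = a * r * b" by (rule multiplesE)
    have "restrict_gens X x = restrict_gens X a * r * restrict_gens X b"
      using r assms restrict_gens_id[of r X] by (auto simp: x restrict_gens_def lift_mult)
    moreover have "r \<in> Idl\<^bsub>?A\<^esub> R" using r genideal_self[OF assms] by blast
    ultimately show ?case
      using I.I_l_closed[OF _ restrict_gens_closed] I.I_r_closed[OF _ restrict_gens_closed]
      by (simp add: free_alg_simps)
  next
    case zero
    then show ?case using I.zero_closed by (simp add: additive.zero[OF additive_restrict_gens] free_alg_simps)
  next
    case (add x y)
    then show ?case using I.a_closed by (simp add: restrict_gens_simps free_alg_simps)
  next
    case (minus x)
    have "- restrict_gens X x = (- 1) * restrict_gens X x" by simp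
    moreover have "(- 1 :: ('k, 'g) free) \<in> carrier ?A" by (intro free_alg_closed)
    ultimately show ?case
      using I.I_l_closed[OF minus.IH, of "- 1"] by (simp add: additive.minus[OF additive_restrict_gens] free_alg_simps)
  qed
  then show "ideal_span R \<inter> carrier ?A \<subseteq> Idl\<^bsub>?A\<^esub> R"
    using restrict_gens_id by fastforce
qed

section \<open>Quotients of free algebras as sets of cosets\<close>

locale presentation =
  fixes X :: "'g set" and R :: "('k::field, 'g) free set"
  assumes rels_closed: "R \<subseteq> carrier (free_alg X)"
begin

abbreviation A :: "('k, 'g) free ring" where "A \<equiv> free_alg X"

definition coset :: "('k, 'g) free \<Rightarrow> ('k, 'g) free set" where
  "coset x = Idl\<^bsub>A\<^esub> R +>\<^bsub>A\<^esub> x"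

lemma mem_coset: "x \<in> carrier A \<Longrightarrow> y \<in> coset x \<longleftrightarrow> y \<in> carrier A \<and> cong_ideal R y x"
proof
  assume x: "x \<in> carrier A"
  show "y \<in> carrier A \<and> cong_ideal R y x" if "y \<in> coset x"
    using that x by (auto simp: coset_def a_r_coset_def' genideal_free_alg[OF rels_closed]
        free_alg_simps cong_span_def free_alg_closed)
  show "y \<in> coset x" if "y \<in> carrier A \<and> cong_ideal R y x"
  proof -
    have "y - x \<in> ideal_span R \<inter> carrier A"
      using that x by (simp add: cong_span_def free_alg_closed)
    then have "\<exists>z\<in>ideal_span R \<inter> carrier A. y = z + x" by (intro bexI[of _ "y - x"]) auto
    then show ?thesis
      by (auto simp: coset_def a_r_coset_def' genideal_free_alg[OF rels_closed] free_alg_simps)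
  qed
qed

lemma coset_eq_iff:
  assumes "x \<in> carrier A" and "y \<in> carrier A"
  shows "coset x = coset y \<longleftrightarrow> cong_ideal R x y"
proof
  assume "coset x = coset y"
  moreover have "x \<in> coset x" using assms by (simp add: mem_coset)
  ultimately show "cong_ideal R x y" using assms by (simp add: mem_coset)
next
  assume "cong_ideal R x y"
  then have "cong_ideal R z x \<longleftrightarrow> cong_ideal R z y" for z
    using cong_span_trans cong_span_sym by blast
  then show "coset x = coset y"
    using assms by (simp add: set_eq_iff mem_coset)
qed

lemma presented_alg_carrier: "carrier (presented_alg X R) = coset ` carrier A"
  by (auto simp: presented_alg_def Let_def FactRing_def A_RCOSETS_def' coset_def)

lemma presented_gen: "presented_gen X R g = coset (gen g)"
  by (simp add: presented_gen_def coset_def)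

lemma ideal_rels: "ideal (Idl\<^bsub>A\<^esub> R) A"
  by (rule ring.genideal_ideal[OF ring_free_alg rels_closed])

lemma presented_alg_one: "one (presented_alg X R) = coset 1"
  by (simp add: presented_alg_def Let_def FactRing_def coset_def free_alg_simps)

lemma presented_alg_zero: "zero (presented_alg X R) = coset 0"
proof -
  have "Idl\<^bsub>A\<^esub> R = coset 0"
    using genideal_free_alg[OF rels_closed] mem_coset[of 0] by (auto simp: free_alg_closed cong_span_0)
  then show ?thesis by (simp add: presented_alg_def Let_def FactRing_def)
qed

lemma presented_alg_mult:
  "x \<in> carrier A \<Longrightarrow> y \<in> carrier A \<Longrightarrow> mult (presented_alg X R) (coset x) (coset y) = coset (x * y)"
  using ideal.rcoset_mult_add[OF ideal_rels, of x y]
  by (simp add: presented_alg_def Let_def FactRing_def coset_def free_alg_simps)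

lemma presented_alg_add:
  "x \<in> carrier A \<Longrightarrow> y \<in> carrier A \<Longrightarrow> add (presented_alg X R) (coset x) (coset y) = coset (x + y)"
  using abelian_subgroup.a_rcos_sum[OF abelian_subgroupI3[OF ideal.axioms(1)[OF ideal_rels] ring.is_abelian_group[OF ring_free_alg]], of x y]
  by (simp add: presented_alg_def Let_def FactRing_def coset_def free_alg_simps)

text \<open>The definition takes a union over the coset; scaling respects the congruence, so all
  members give one and the same coset.\<close>

lemma presented_alg_smult:
  assumes "x \<in> carrier A"
  shows "smult (presented_alg X R) c (coset x) = coset (c \<cdot>\<^sub>f x)"
proof -
  have "(\<Union>y\<in>coset x. coset (c \<cdot>\<^sub>f y)) = (\<Union>y\<in>coset x. coset (c \<cdot>\<^sub>f x))"
    using assms by (intro SUP_cong refl) (simp add: mem_coset coset_eq_iff free_alg_closed cong_ideal_scale)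
  moreover have "x \<in> coset x" using assms by (simp add: mem_coset)
  moreover have "smult (presented_alg X R) c (coset x) = (\<Union>y\<in>coset x. coset (c \<cdot>\<^sub>f y))"
    by (simp add: presented_alg_def Let_def coset_def)
  ultimately show ?thesis by auto
qed

end

text \<open>Reduces the isomorphism to \<open>inj\<close>, a statement about ideals of free
  algebras. Surjectivity is automatic, because the generated subalgebra consists exactly of the
  cosets of elements over \<open>X\<close>.\<close>

lemma presented_subalgebra:
  fixes R S :: "('k::field, 'g) free set"
  assumes XY: "X \<subseteq> Y" and R: "R \<subseteq> carrier (free_alg X)" and S: "S \<subseteq> carrier (free_alg Y)" and RS: "R \<subseteq> S"
    and inj: "\<And>x. x \<in> carrier (free_alg X) \<Longrightarrow> x \<in> ideal_span S \<Longrightarrow> x \<in> ideal_span R"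
  shows "\<exists>\<phi> \<in> alg_iso (presented_alg X R) (generated_subalg (presented_alg Y S) (presented_gen Y S ` X)).
    \<forall>g\<in>X. \<phi> (presented_gen X R g) = presented_gen Y S g"
proof -
  interpret P: presentation X R by standard (rule R)
  interpret Q: presentation Y S by standard (rule S)
  let ?B = "generated_subalg (presented_alg Y S) (presented_gen Y S ` X)"
  have sub: "x \<in> carrier Q.A" if "x \<in> carrier P.A" for x
    using that XY by (auto simp: free_alg_def)
  have cong: "cong_ideal S x y \<longleftrightarrow> cong_ideal R x y" if "x \<in> carrier P.A" "y \<in> carrier P.A" for x y
  proof
    assume "cong_ideal R x y"
    then have "x - y \<in> ideal_span R" by (simp add: cong_span_def)
    then have "x - y \<in> ideal_span S"
    proof (rule additive_span_image[of "\<lambda>x. x", rotated 2])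
      show "x \<in> ideal_span S" if "x \<in> multiples R" for x
        using that RS by (intro additive_span.base) (auto simp: multiples_def)
    qed (simp add: additive_def)
    then show "cong_ideal S x y" by (simp add: cong_span_def)
  qed (use that inj in \<open>simp add: cong_span_def free_alg_closed\<close>)
  \<comment> \<open>Since \<open>R \<subseteq> S\<close>, the elements of a coset modulo
    \<open>R\<close> all have the same coset modulo \<open>S\<close>, and the union is that
    coset.\<close>
  define \<phi> where "\<phi> C = (\<Union>x\<in>C. Q.coset x)" for C
  have \<phi>: "\<phi> (P.coset x) = Q.coset x" if x: "x \<in> carrier P.A" for x
  proof -
    have "\<phi> (P.coset x) = (\<Union>y\<in>P.coset x. Q.coset x)"
      unfolding \<phi>_def using x
      by (intro SUP_cong refl) (simp add: P.mem_coset Q.coset_eq_iff sub cong)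
    moreover have "x \<in> P.coset x" using x by (simp add: P.mem_coset)
    ultimately show ?thesis by auto
  qed
  have B_ops: "mult ?B = mult (presented_alg Y S)" "one ?B = one (presented_alg Y S)"
    "add ?B = add (presented_alg Y S)" "smult ?B = smult (presented_alg Y S)"
    by (simp_all add: generated_subalg_def)
  have gens: "presented_gen Y S ` X = (\<lambda>g. Q.coset (gen g)) ` X"
    by (simp add: Q.presented_gen)
  have carrier: "carrier ?B = Q.coset ` carrier P.A"
  proof
    have "C \<in> Q.coset ` carrier P.A"
      if "C \<in> alg_span (presented_alg Y S) ((\<lambda>g. Q.coset (gen g)) ` X)" for C
      using that
    proof induction
      case (incl C)
      then show ?case by (auto simp: free_alg_closed)
    next
      case (add C D)
      then show ?case by (auto simp: Q.presented_alg_add sub free_alg_closed)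
    next
      case (mult C D)
      then show ?case by (auto simp: Q.presented_alg_mult sub free_alg_closed)
    next
      case (smult C c)
      then show ?case by (auto simp: Q.presented_alg_smult sub free_alg_closed)
    qed (simp_all add: Q.presented_alg_one Q.presented_alg_zero free_alg_closed)
    then show "carrier ?B \<subseteq> Q.coset ` carrier P.A"
      by (auto simp: generated_subalg_def gens)
    let ?W = "alg_span (presented_alg Y S) (presented_gen Y S ` X)"
    \<comment> \<open>Restrictions exhaust the free algebra on \<open>X\<close>, and a letter
      outside \<open>X\<close> contributes the zero coset.\<close>
    have "Q.coset (restrict_gens X x) \<in> ?W" for x
    proof (induction x rule: free_induct)
      case (const c)
      have "smult (presented_alg Y S) c (one (presented_alg Y S)) \<in> ?W"
        by (intro alg_span.intros)
      then show ?case
        by (simp add: Q.presented_alg_one Q.presented_alg_smult free_alg_closed restrict_gens_simps scale_def)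
    next
      case (gen g x)
      show ?case
      proof (cases "g \<in> X")
        case True
        then have "Q.coset (gen g) \<in> ?W" unfolding gens by (intro alg_span.incl) auto
        then have "mult (presented_alg Y S) (Q.coset (gen g)) (Q.coset (restrict_gens X x)) \<in> ?W"
          using gen by (rule alg_span.mult)
        then show ?thesis
          using True Q.presented_alg_mult[OF sub sub, of "gen g" "restrict_gens X x"]
          by (simp add: free_alg_closed restrict_gens_closed restrict_gens_simps)
      next
        case False
        then show ?thesis
          using alg_span.zero[of "presented_alg Y S"] by (simp add: restrict_gens_simps Q.presented_alg_zero)
      qed
    next
      case (add x y)
      then show ?case
        using alg_span.add[OF add]
        by (simp add: Q.presented_alg_add sub restrict_gens_closed restrict_gens_simps)
    qed
    then have "Q.coset x \<in> ?W" if "x \<in> carrier P.A" for x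
      using restrict_gens_id[OF that] by metis
    then show "Q.coset ` carrier P.A \<subseteq> carrier ?B"
      by (auto simp: generated_subalg_def)
  qed
  have hom: "\<phi> \<in> ring_hom (presented_alg X R) ?B"
    by (rule ring_hom_memI)
      (auto simp: P.presented_alg_carrier carrier B_ops P.presented_alg_mult Q.presented_alg_mult
        P.presented_alg_add Q.presented_alg_add P.presented_alg_one Q.presented_alg_one \<phi> sub free_alg_closed)
  have "bij_betw \<phi> (carrier (presented_alg X R)) (carrier ?B)"
    unfolding bij_betw_def inj_on_def carrier P.presented_alg_carrier
    by (auto simp: \<phi> image_image Q.coset_eq_iff P.coset_eq_iff sub cong)
  moreover have "\<phi> (smult (presented_alg X R) c C) = smult ?B c (\<phi> C)"
    if "C \<in> carrier (presented_alg X R)" for c C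
    using that by (auto simp: P.presented_alg_carrier B_ops P.presented_alg_smult Q.presented_alg_smult
        \<phi> sub free_alg_closed)
  ultimately have "\<phi> \<in> alg_iso (presented_alg X R) ?B"
    using hom by (simp add: alg_iso_def ring_iso_def)
  moreover have "\<phi> (presented_gen X R g) = presented_gen Y S g" if "g \<in> X" for g
    using that by (simp add: P.presented_gen Q.presented_gen \<phi> free_alg_closed)
  ultimately show ?thesis by blast
qed

section \<open>The tensor product of two free algebras\<close>

text \<open>Polynomial mappings with coefficients in \<open>A\<close> serve as the tensor product \<open>T \<otimes> A\<close>:
  words of \<open>T\<close> commute with the coefficients.\<close>

type_synonym ('k, 'h, 'g) tensor = "'h word \<Rightarrow>\<^sub>0 ('k, 'g) free"

text \<open>\<open>left f * const a\<close> is the pure tensor f \<otimes> a; on this type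
  \<open>const\<close> places an element of the second factor at the empty word.\<close>

definition left :: "('k::field, 'h) free \<Rightarrow> ('k, 'h, 'g) tensor" where
  "left = additive_ext (\<lambda>w c. Poly_Mapping.single w (const c))"

lemma additive_left: "additive left"
  unfolding left_def by (intro additive_additive_ext) (simp add: additive_def single_add)

lemma left_single: "left (Poly_Mapping.single w c) = Poly_Mapping.single w (const c)"
  unfolding left_def by (rule additive_ext_single) (simp add: additive_def single_add)

lemmas left_add = additive.add[OF additive_left]

lemma left_mult: "left (x * y) = left x * left y"
proof (induction x rule: poly_mapping_additive_induct)
  case (single u a)
  show ?case
    by (induction y rule: poly_mapping_additive_induct)
      (simp_all add: mult_single left_single distrib_left left_add)
qed (simp add: distrib_right left_add)

text \<open>Scalars pass between the two factors, so the tensor product is taken over the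
  field.\<close>

lemma left_scale: "left (c \<cdot>\<^sub>f x) * const a = left x * const (c \<cdot>\<^sub>f a)"
proof (induction x rule: poly_mapping_additive_induct)
  case (single w b)
  then show ?case
    by (simp add: scale_single left_single mult_single scale_def mult.assoc[symmetric] mult.commute)
qed (simp add: scale_distrib left_add distrib_right)

lemma left_one [simp]: "left 1 = 1"
  by (metis left_single single_one)

lemma tensor_induct [case_names tensor add]:
  assumes "\<And>f a. P (left f * const a)" and "\<And>x y. P x \<Longrightarrow> P y \<Longrightarrow> P (x + y)"
  shows "P x"
proof (induction x rule: poly_mapping_additive_induct)
  case (single w a)
  have "Poly_Mapping.single w a = left (Poly_Mapping.single w 1) * const a"
    by (simp add: left_single mult_single)
  then show ?case using assms(1) by metis
qed (rule assms)

definition linear_map :: "(('k::field, 'h) free \<Rightarrow> ('k, 'g) free) \<Rightarrow> bool" where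
  "linear_map \<phi> \<longleftrightarrow> additive \<phi> \<and> (\<forall>c x. \<phi> (c \<cdot>\<^sub>f x) = c \<cdot>\<^sub>f \<phi> x)"

lemma linear_map_twist: "linear_map (twist c)"
  by (simp add: linear_map_def additive_twist twist_simps)

lemma linear_map_skew_deriv: "linear_map (skew_deriv s c i)"
  by (simp add: linear_map_def additive_skew_deriv skew_deriv_scale)

lemma linear_map_scale: "linear_map \<phi> \<Longrightarrow> linear_map (\<lambda>x. c \<cdot>\<^sub>f \<phi> x)"
  by (simp add: linear_map_def additive_def scale_distrib mult.commute)

text \<open>The tensor product of \<open>\<phi>\<close> with left multiplication by
  \<open>t\<close>. It is given through the values of \<open>\<phi>\<close> on words, hence the
  linearity assumption whenever it is evaluated on pure tensors.\<close>

definition tensor_op ::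
  "(('k::field, 'h) free \<Rightarrow> ('k, 'h) free) \<Rightarrow> ('k, 'g) free \<Rightarrow> ('k, 'h, 'g) tensor \<Rightarrow> ('k, 'h, 'g) tensor"
  where "tensor_op \<phi> t = additive_ext (\<lambda>w a. left (\<phi> (Poly_Mapping.single w 1)) * const (t * a))"

lemma additive_tensor_op: "additive (tensor_op \<phi> t)"
  unfolding tensor_op_def
  by (intro additive_additive_ext) (simp add: additive_def distrib_left single_add)

lemma tensor_op_tensor:
  assumes "linear_map \<phi>"
  shows "tensor_op \<phi> t (left f * const a) = left (\<phi> f) * const (t * a)"
proof (induction f rule: poly_mapping_additive_induct)
  case (single w b)
  have *: "Poly_Mapping.single w b = b \<cdot>\<^sub>f Poly_Mapping.single w 1"
    by (simp add: scale_single)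
  have "tensor_op \<phi> t (left (Poly_Mapping.single w b) * const a) =
      left (\<phi> (Poly_Mapping.single w 1)) * const (t * (const b * a))"
    unfolding left_single mult_single tensor_op_def
    by (subst additive_ext_single) (simp_all add: additive_def distrib_left single_add)
  also have "\<dots> = left (b \<cdot>\<^sub>f \<phi> (Poly_Mapping.single w 1)) * const (t * a)"
    by (simp add: left_scale flip: scale_def)
  finally show ?case using assms * by (simp add: linear_map_def)
next
  case (add x y)
  have "additive \<phi>" using assms by (simp add: linear_map_def)
  then show ?case
    using add by (simp add: left_add distrib_right additive.add additive.add[OF additive_tensor_op])
qed

definition contract :: "(('k::field, 'h) free \<Rightarrow> ('k, 'g) free) \<Rightarrow> ('k, 'h, 'g) tensor \<Rightarrow> ('k, 'g) free"
  where "contract \<phi> = additive_ext (\<lambda>w a. \<phi> (Poly_Mapping.single w 1) * a)"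

lemma additive_contract: "additive (contract \<phi>)"
  unfolding contract_def by (intro additive_additive_ext) (rule additive_mult_left)

lemma contract_tensor:
  assumes "linear_map \<phi>"
  shows "contract \<phi> (left f * const a) = \<phi> f * a"
proof (induction f rule: poly_mapping_additive_induct)
  case (single w b)
  have *: "Poly_Mapping.single w b = b \<cdot>\<^sub>f Poly_Mapping.single w 1"
    by (simp add: scale_single)
  have "contract \<phi> (left (Poly_Mapping.single w b) * const a) =
      \<phi> (Poly_Mapping.single w 1) * (const b * a)"
    unfolding left_single mult_single contract_def
    by (subst additive_ext_single) (simp_all add: additive_mult_left)
  then show ?case using assms * by (simp add: linear_map_def flip: scale_def)
next
  case (add x y)
  have "additive \<phi>" using assms by (simp add: linear_map_def)
  then show ?case
    using add by (simp add: left_add distrib_right additive.add additive.add[OF additive_contract])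
qed

section \<open>The ideal of Serre elements\<close>

type_synonym 'f lfree = "('f poly fract, nat) free"

lemma q_nonzero [simp]: "(q :: 'f::field_char_0 poly fract) \<noteq> 0"
  by (simp add: q_def Zero_fract_def eq_fract)

lemma q_cancel: "(q :: 'f::field_char_0 poly fract) * (inverse q * x) = x"
  by (simp flip: mult.assoc)

lemma qi_nonzero [simp]: "(qi m i :: 'f::field_char_0 poly fract) \<noteq> 0"
  by (simp add: qi_def)

text \<open>Here \<open>x\<close> and \<open>y\<close> are the root vectors for (m-1,m+1) and
  (m-1,m+2): their coefficients are \<open>inverse (qi m m) = inverse q\<close> and
  \<open>inverse (qi m (m + 1)) = q\<close>. Both \<open>y\<close> and \<open>b\<close> are odd,
  whence the plus sign.\<close>

definition odd_serre :: "nat \<Rightarrow> 'f::field_char_0 lfree" where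
  "odd_serre m = (let a = gen (m - 1); b = gen m; d = gen (m + 1);
     x = a * b - inverse q \<cdot>\<^sub>f (b * a); y = x * d - q \<cdot>\<^sub>f (d * x)
   in y * b + b * y)"

text \<open>The letter \<open>i\<close> is read as E_i through \<open>E_hom\<close> and as F_i
  through \<open>F_hom\<close>; one set of elements serves both halves of the algebra.\<close>

inductive_set serre :: "nat \<Rightarrow> nat \<Rightarrow> 'f::field_char_0 lfree set" for m n where
  square: "gen m * gen m \<in> serre m n"
| commute: "i \<in> {1..<m+n} \<Longrightarrow> j \<in> {1..<m+n} \<Longrightarrow> \<bar>int i - int j\<bar> > 1 \<Longrightarrow>
    gen i * gen j - gen j * gen i \<in> serre m n"
| cubic: "i \<in> {1..<m+n} \<Longrightarrow> j \<in> {1..<m+n} \<Longrightarrow> \<bar>int i - int j\<bar> = 1 \<Longrightarrow> i \<noteq> m \<Longrightarrow>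
    gen i * gen i * gen j - (q + inverse q) \<cdot>\<^sub>f (gen i * gen j * gen i) + gen j * gen i * gen i
      \<in> serre m n"
| odd: "m \<ge> 2 \<Longrightarrow> n \<ge> 2 \<Longrightarrow> odd_serre m \<in> serre m n"

definition parity :: "nat \<Rightarrow> nat \<Rightarrow> nat \<Rightarrow> 'f::field_char_0 poly fract" where
  "parity m i j = (if i = m \<and> j = m then -1 else 1)"

text \<open>The characters by which \<open>K\<^sub>i K\<^sub>i\<^sub>+\<^sub>1\<^sup>-\<^sup>1\<close> and its inverse
  commute with the generators \<open>E\<^sub>j\<close> are the ones below with \<open>u = q\<close> and \<open>u = q\<^sup>-\<^sup>1\<close>.\<close>

definition cartan_char :: "nat \<Rightarrow> nat \<Rightarrow> (nat \<Rightarrow> 'f::field_char_0 poly fract) \<Rightarrow> bool" where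
  "cartan_char m i c \<longleftrightarrow> (\<exists>u. (u = q \<or> u = inverse q) \<and>
     (\<forall>j. \<bar>int i - int j\<bar> > 1 \<longrightarrow> c j = 1) \<and>
     (if i = m then c i = 1 \<and> c (i - 1) = u \<and> c (i + 1) = inverse u
      else c i = u * u \<and> c (i - 1) = inverse u \<and> c (i + 1) = inverse u))"

text \<open>Every Serre element is homogeneous in each letter separately, so a diagonal twist only
  rescales it.\<close>

lemma twist_serre:
  fixes c :: "nat \<Rightarrow> 'f::field_char_0 poly fract"
  assumes "r \<in> serre m n"
  shows "\<exists>k. twist c r = k \<cdot>\<^sub>f r"
  using assms
proof cases
  case square
  then show ?thesis by (auto simp: twist_simps)
next
  case (commute i j)
  then have "twist c r = (c i * c j) \<cdot>\<^sub>f r"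
    by (simp add: twist_simps scale_distrib mult.commute)
  then show ?thesis ..
next
  case (cubic i j)
  then have "twist c r = (c i * c i * c j) \<cdot>\<^sub>f r"
    by (simp add: twist_simps scale_distrib mult_ac)
  then show ?thesis ..
next
  case odd
  then have "twist c r = (c (m - 1) * c m * c m * c (m + 1)) \<cdot>\<^sub>f r"
    unfolding odd(1) by (simp add: odd_serre_def Let_def twist_simps scale_distrib algebra_simps)
  then show ?thesis ..
qed

lemma ideal_span_twist_serre:
  assumes "x \<in> ideal_span (serre m n)"
  shows "twist c x \<in> ideal_span (serre m n)"
  using additive_twist _ _ assms
proof (rule ideal_span_hom)
  show "twist c r \<in> ideal_span (serre m n)" if "r \<in> serre m n" for r
    using twist_serre[OF that, of c] ideal_span_superset[OF that] ideal_span_scale by metis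
qed (rule twist_simps)

text \<open>Removing \<open>a\<close> or \<open>d\<close> leaves multiples of \<open>b * b\<close>;
  removing \<open>b\<close> leaves commutators with \<open>a * d - d * a\<close>. This is the only
  kind of Serre element whose skew derivatives need not vanish.\<close>

lemma skew_deriv_odd_serre:
  fixes c :: "nat \<Rightarrow> 'f::field_char_0 poly fract"
  assumes m: "m \<ge> 2" and n: "n \<ge> 2" and c: "cartan_char m i c"
  shows "skew_deriv (parity m i) c i (odd_serre m) \<in> ideal_span (serre m n)"
proof -
  define a b d :: "'f lfree" where abd: "a = gen (m - 1)" "b = gen m" "d = gen (m + 1)"
  have bb: "b * b \<in> ideal_span (serre m n)"
    using ideal_span_superset[OF serre.square] by (simp add: abd)
  have ad: "a * d - d * a \<in> ideal_span (serre m n)"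
    unfolding abd using m n by (intro ideal_span_superset serre.commute) auto
  obtain u where u: "u = q \<or> u = inverse q"
    and far: "\<And>j. \<bar>int i - int j\<bar> > 1 \<Longrightarrow> c j = 1"
    and near: "if i = m then c i = 1 \<and> c (i - 1) = u \<and> c (i + 1) = inverse u
      else c i = u * u \<and> c (i - 1) = inverse u \<and> c (i + 1) = inverse u"
    using c unfolding cartan_char_def by blast
  have expand: "odd_serre m = d * (b * (a * b)) - q \<cdot>\<^sub>f (d * (a * (b * b)))
      - inverse q \<cdot>\<^sub>f (b * (a * (d * b))) + a * (b * (d * b)) + b * (d * (b * a))
      - q \<cdot>\<^sub>f (b * (d * (a * b))) - inverse q \<cdot>\<^sub>f (b * (b * (a * d))) + b * (a * (b * d))"
    unfolding odd_serre_def Let_def abd[symmetric]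
    by (simp add: algebra_simps scale_distrib)
  consider "i = m - 1" | "i = m" | "i = m + 1" | "i \<notin> {m - 1, m, m + 1}" by blast
  then show ?thesis
  proof cases
    case 1
    then have cs: "c m = inverse u" "c (m + 1) = 1"
      using near far[of "m + 1"] m by (auto split: if_splits)
    \<comment> \<open>The terms in \<open>b * d * b\<close> cancel: their coefficient is
      \<open>(c m - q) * (c m - inverse q)\<close>, and \<open>c m\<close> is \<open>q\<close> or
      \<open>inverse q\<close>.\<close>
    have "skew_deriv (parity m i) c i (odd_serre m) =
        (c m - q * c m * c m) \<cdot>\<^sub>f (d * (b * b)) + (c m - inverse q) \<cdot>\<^sub>f (b * b * d)"
      using 1 m u cs unfolding expand abd
      by (auto simp: skew_deriv_simps parity_def twist_simps scale_distrib algebra_simps)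
    then show ?thesis
      by (simp add: bb ideal_span_mult_left ideal_span_mult_right additive_span.add ideal_span_scale
          del: scale_mult_left scale_mult_right)
  next
    case 2
    then have cs: "c m = 1" "c (m - 1) = u" "c (m + 1) = inverse u"
      using near by auto
    \<comment> \<open>The coefficients \<open>inverse u - inverse q\<close> and \<open>u - q\<close>
      both occur; they are opposite because \<open>u + inverse u = q + inverse q\<close>.\<close>
    have "skew_deriv (parity m i) c i (odd_serre m) =
        (inverse u - inverse q) \<cdot>\<^sub>f ((a * d - d * a) * b - b * (a * d - d * a))"
      using 2 m u cs unfolding expand abd
      by (auto simp: skew_deriv_simps parity_def scale_minus q_cancel twist_simps scale_distrib algebra_simps)
    then show ?thesis
      by (simp add: ad ideal_span_mult_left ideal_span_mult_right additive_span_diff ideal_span_scale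
          del: scale_mult_left scale_mult_right)
  next
    case 3
    then have cs: "c m = inverse u" "c (m - 1) = 1"
      using near far[of "m - 1"] m by (auto split: if_splits)
    have "skew_deriv (parity m i) c i (odd_serre m) =
        (c m - q * c m * c m) \<cdot>\<^sub>f (a * (b * b)) + (c m - inverse q) \<cdot>\<^sub>f (b * b * a)"
      using 3 m u cs unfolding expand abd
      by (auto simp: skew_deriv_simps parity_def twist_simps scale_distrib algebra_simps)
    then show ?thesis
      by (simp add: bb ideal_span_mult_left ideal_span_mult_right additive_span.add ideal_span_scale
          del: scale_mult_left scale_mult_right)
  next
    case 4
    then have "skew_deriv (parity m i) c i (odd_serre m) = 0"
      unfolding expand abd by (auto simp: skew_deriv_simps)
    then show ?thesis by (simp add: additive_span.zero)
  qed
qed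

text \<open>For the quadratic and cubic elements the derivatives vanish exactly. The square depends
  on the sign: for \<open>i = m\<close>, passing \<open>gen m\<close> gives -1 while
  \<open>c m = 1\<close>, so its two terms cancel.\<close>

lemma skew_deriv_serre:
  fixes c :: "nat \<Rightarrow> 'f::field_char_0 poly fract"
  assumes "i \<ge> 1" and c: "cartan_char m i c" and "r \<in> serre m n"
  shows "skew_deriv (parity m i) c i r \<in> ideal_span (serre m n)"
proof -
  obtain u where u: "u = q \<or> u = inverse q"
    and far: "\<And>j. \<bar>int i - int j\<bar> > 1 \<Longrightarrow> c j = 1"
    and near: "if i = m then c i = 1 \<and> c (i - 1) = u \<and> c (i + 1) = inverse u
      else c i = u * u \<and> c (i - 1) = inverse u \<and> c (i + 1) = inverse u"
    using c unfolding cartan_char_def by blast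
  from assms(3) show ?thesis
  proof cases
    case square
    then have "skew_deriv (parity m i) c i r = 0"
      using near by (auto simp: skew_deriv_simps parity_def twist_simps scale_minus)
    then show ?thesis by (simp add: additive_span.zero)
  next
    case (commute k l)
    then have "skew_deriv (parity m i) c i r = 0"
      using far by (auto simp: skew_deriv_simps parity_def twist_simps)
    then show ?thesis by (simp add: additive_span.zero)
  next
    case (cubic k l)
    \<comment> \<open>In the first two cases the coefficients cancel by
      \<open>u + inverse u = q + inverse q\<close>; for \<open>i = l\<close> what is left is the
      quadratic polynomial with roots \<open>q\<close> and \<open>inverse q\<close>, evaluated at
      \<open>c k\<close>.\<close>
    consider "i = k" | "i = l" | "i \<notin> {k, l}" by blast
    then have "skew_deriv (parity m i) c i r = 0"
    proof cases
      case 1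
      have l: "l = k + 1 \<or> l = k - 1" "l \<noteq> k" using cubic by auto
      then have "c k = u * u" "c l = inverse u"
        using near cubic 1 by (auto split: if_splits)
      then show ?thesis
        unfolding cubic(1) using 1 u cubic(5) l(2)
        by (auto simp: skew_deriv_simps parity_def q_cancel twist_simps scale_distrib algebra_simps)
    next
      case 2
      have k: "k = l + 1 \<or> k = l - 1" "l \<noteq> k" using cubic by auto
      then have "c k = u \<or> c k = inverse u"
        using near cubic 2 by (auto split: if_splits)
      then show ?thesis
        unfolding cubic(1) using 2 u cubic(5) k(2)
        by (auto simp: skew_deriv_simps parity_def twist_simps scale_distrib algebra_simps)
    next
      case 3
      then show ?thesis
        unfolding cubic(1) by (auto simp: skew_deriv_simps mult.assoc)
    qed
    then show ?thesis by (simp add: additive_span.zero)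
  next
    case odd
    then show ?thesis using skew_deriv_odd_serre c by blast
  qed
qed

lemma ideal_span_skew_deriv_serre:
  assumes "i \<ge> 1" and "cartan_char m i c" and "x \<in> ideal_span (serre m n)"
  shows "skew_deriv (parity m i) c i x \<in> ideal_span (serre m n)"
  using skew_deriv_serre[OF assms(1,2)] _ _ assms(3)
  by (rule ideal_span_skew_deriv) (auto intro: ideal_span_twist_serre ideal_span_superset)

section \<open>The induced module\<close>

text \<open>The scalar by which conjugation by a toral letter multiplies E_j; for F_j it is the
  inverse. The value 1 at the E and F letters keeps the weight nonzero throughout.\<close>

fun toral_weight :: "nat \<Rightarrow> qgen \<Rightarrow> nat \<Rightarrow> 'f::field_char_0 poly fract" where
  "toral_weight m (gK i) j = qi m i powi (of_bool (i = j) - of_bool (i = j + 1))"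
| "toral_weight m (gKinv i) j = inverse (qi m i powi (of_bool (i = j) - of_bool (i = j + 1)))"
| "toral_weight m (gE i) j = 1"
| "toral_weight m (gF i) j = 1"

lemma toral_weight_nonzero [simp]: "toral_weight m g j \<noteq> 0"
  by (cases g) simp_all

text \<open>The \<open>itself\<close> parameter fixes the type of the ground field inside the
  locale.\<close>

locale quantum_gl =
  fixes m n :: nat and base_field :: "'f::field_char_0 itself"
  assumes m_pos: "m \<ge> 1" and n_pos: "n \<ge> 1"
begin

section \<open>Even generators and toral elements\<close>

abbreviation rels0 :: "'f qfree set" where "rels0 \<equiv> Uq0_rels m n"
abbreviation J :: "'f lfree set" where "J \<equiv> ideal_span (serre m n)"

text \<open>Indices out of range are sent to 0 as well, so that later statements can quantify over
  all natural numbers.\<close>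

definition even_E :: "nat \<Rightarrow> 'f qfree" where
  "even_E l = (if l \<in> {1..<m+n} \<and> l \<noteq> m then E l else 0)"

definition even_F :: "nat \<Rightarrow> 'f qfree" where
  "even_F l = (if l \<in> {1..<m+n} \<and> l \<noteq> m then F l else 0)"

definition toral_gens :: "qgen set" where
  "toral_gens = gK ` {1..m+n} \<union> gKinv ` {1..m+n}"

text \<open>What the module computations need to know about a product of K letters, \<open>c\<close>
  being its character on the E letters; by \<open>toral_mult\<close> the notion passes to
  products.\<close>

definition toral :: "(nat \<Rightarrow> 'f poly fract) \<Rightarrow> 'f qfree \<Rightarrow> bool" where
  "toral c t \<longleftrightarrow> (\<forall>l. c l \<noteq> 0) \<and>
    (\<forall>l. cong_ideal rels0 (t * even_E l) (c l \<cdot>\<^sub>f (even_E l * t))) \<and>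
    (\<forall>l. cong_ideal rels0 (t * even_F l) (inverse (c l) \<cdot>\<^sub>f (even_F l * t))) \<and>
    (\<forall>g\<in>toral_gens. cong_ideal rels0 (t * gen g) (gen g * t))"

lemma even_qgens_simps:
  "gE i \<in> even_qgens m n \<longleftrightarrow> i \<in> {1..<m+n} \<and> i \<noteq> m"
  "gF i \<in> even_qgens m n \<longleftrightarrow> i \<in> {1..<m+n} \<and> i \<noteq> m"
  "gK i \<in> even_qgens m n \<longleftrightarrow> i \<in> {1..m+n}"
  "gKinv i \<in> even_qgens m n \<longleftrightarrow> i \<in> {1..m+n}"
  by (auto simp: even_qgens_def qgens_def)

lemma odd_elem_gen: "odd_elem m (gen g :: 'f qfree) \<longleftrightarrow> odd_gen m g"
  by (simp add: odd_elem_def keys_gen)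

lemma super_comm_gen:
  "super_comm m (E i) (F j) = E i * F j - parity m i j \<cdot>\<^sub>f (F j * (E i :: 'f qfree))"
  by (simp add: super_comm_def odd_elem_gen parity_def scale_minus)

definition toral_plus :: "nat \<Rightarrow> 'f qfree" where
  "toral_plus i = K i * Kinv (i + 1)"

definition toral_minus :: "nat \<Rightarrow> 'f qfree" where
  "toral_minus i = Kinv i * K (i + 1)"

definition char_plus :: "nat \<Rightarrow> nat \<Rightarrow> 'f poly fract" where
  "char_plus i l = toral_weight m (gK i) l * toral_weight m (gKinv (i + 1)) l"

definition char_minus :: "nat \<Rightarrow> nat \<Rightarrow> 'f poly fract" where
  "char_minus i l = toral_weight m (gKinv i) l * toral_weight m (gK (i + 1)) l"

text \<open>Zero out of range, which makes \<open>E_op i\<close> vanish there and removes range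
  conditions from the exchange rules.\<close>

definition coroot_factor :: "nat \<Rightarrow> 'f poly fract" where
  "coroot_factor i = (if i \<in> {1..<m+n} then 1 / (qi m i - inverse (qi m i)) else 0)"

section \<open>Exchange rules in the even algebra\<close>

lemma rel0_mem:
  "r \<in> R1 m n \<union> R2 m n \<union> R3 m n \<union> R5 m n \<union> R6 m n \<union> R7 m n \<Longrightarrow>
    r \<in> carrier (free_alg (even_qgens m n)) \<Longrightarrow> r \<in> rels0"
  by (simp add: Uq0_rels_def)

lemma rels0_toral_commute:
  assumes "i \<in> {1..m+n}" and "j \<in> {1..m+n}"
  shows "cong_ideal rels0 (K i * K j) (K j * K i)"
proof (intro cong_ideal_rel rel0_mem UnI1)
  show "K i * K j - K j * K i \<in> R1 m n" unfolding R1_def using assms by blast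
qed (use assms in \<open>simp add: free_alg_closed even_qgens_simps\<close>)

lemma rels0_toral_inverse:
  assumes "i \<in> {1..m+n}"
  shows "cong_ideal rels0 (K i * Kinv i) 1" and "cong_ideal rels0 (Kinv i * K i) 1"
proof -
  have "K i * Kinv i - 1 \<in> (R1 m n :: 'f qfree set)" "Kinv i * K i - 1 \<in> (R1 m n :: 'f qfree set)"
    unfolding R1_def using assms by blast+
  then have "K i * Kinv i - 1 \<in> rels0" "Kinv i * K i - 1 \<in> rels0"
    using assms by (simp_all add: Uq0_rels_def free_alg_closed even_qgens_simps)
  then show "cong_ideal rels0 (K i * Kinv i) 1" "cong_ideal rels0 (Kinv i * K i) 1"
    by (simp_all add: cong_ideal_rel)
qed

lemma rels0_toral_E:
  assumes "i \<in> {1..m+n}"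
  shows "cong_ideal rels0 (K i * even_E j * Kinv i) (toral_weight m (gK i) j \<cdot>\<^sub>f even_E j)"
proof (cases "j \<in> {1..<m+n} \<and> j \<noteq> m")
  case True
  then have "K i * E j * Kinv i - (qi m i powi (of_bool (i = j) - of_bool (i = j + 1))) \<cdot>\<^sub>f E j \<in> rels0"
    using assms by (intro rel0_mem UnI1[OF UnI1[OF UnI1[OF UnI1[OF UnI2]]]])
      (unfold R2_def, blast, simp add: free_alg_closed even_qgens_simps)
  then show ?thesis using True by (simp only: even_E_def toral_weight.simps cong_ideal_rel if_True simp_thms)
next
  case False
  then have "even_E j = 0" by (auto simp: even_E_def)
  then show ?thesis by simp
qed

lemma rels0_toral_F:
  assumes "i \<in> {1..m+n}"
  shows "cong_ideal rels0 (K i * even_F j * Kinv i) (inverse (toral_weight m (gK i) j) \<cdot>\<^sub>f even_F j)"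
proof (cases "j \<in> {1..<m+n} \<and> j \<noteq> m")
  case True
  then have "K i * F j * Kinv i - (qi m i powi (- (of_bool (i = j) - of_bool (i = j + 1)))) \<cdot>\<^sub>f F j \<in> rels0"
    using assms by (intro rel0_mem UnI1[OF UnI1[OF UnI1[OF UnI1[OF UnI2]]]])
      (unfold R2_def, blast, simp add: free_alg_closed even_qgens_simps)
  moreover have "qi m i powi (- (of_bool (i = j) - of_bool (i = j + 1))) =
      inverse (toral_weight m (gK i) j :: 'f poly fract)"
    by (simp only: toral_weight.simps power_int_minus)
  ultimately show ?thesis using True by (simp only: even_F_def cong_ideal_rel if_True simp_thms)
next
  case False
  then have "even_F j = 0" by (auto simp: even_F_def)
  then show ?thesis by simp
qed

text \<open>Passes from the conjugation form of (R2) to an exchange rule, for \<open>t\<close> and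
  at once for its inverse \<open>t'\<close>.\<close>

lemma cong_ideal_conj:
  assumes "cong_ideal R (t * x * t') (c \<cdot>\<^sub>f y)" and "cong_ideal R (t' * t) 1" and "cong_ideal R (t * t') 1" and "c \<noteq> 0"
  shows "cong_ideal R (t * x) (c \<cdot>\<^sub>f (y * t))" and "cong_ideal R (t' * y) (inverse c \<cdot>\<^sub>f (x * t'))"
proof -
  have "cong_ideal R (t * x * (t' * t)) (t * x * 1)"
    by (intro cong_ideal_mult assms cong_span_refl)
  moreover have "cong_ideal R (t * x * t' * t) (c \<cdot>\<^sub>f y * t)"
    by (intro cong_ideal_mult assms cong_span_refl)
  ultimately show "cong_ideal R (t * x) (c \<cdot>\<^sub>f (y * t))"
    using cong_span_sym cong_span_trans by (fastforce simp: mult.assoc)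
  have "cong_ideal R (t' * (c \<cdot>\<^sub>f y)) (t' * (t * x * t'))"
    by (intro cong_ideal_mult cong_span_sym[OF assms(1)] cong_span_refl)
  also have "t' * (t * x * t') = (t' * t) * (x * t')" by (simp add: mult.assoc)
  also have "cong_ideal R \<dots> (1 * (x * t'))"
    by (intro cong_ideal_mult assms cong_span_refl)
  finally have "cong_ideal R (inverse c \<cdot>\<^sub>f (t' * (c \<cdot>\<^sub>f y))) (inverse c \<cdot>\<^sub>f (1 * (x * t')))"
    by (rule cong_ideal_scale)
  then show "cong_ideal R (t' * y) (inverse c \<cdot>\<^sub>f (x * t'))"
    using assms(4) by simp
qed

text \<open>What commutes with \<open>K i\<close> commutes with its inverse; the second claim
  applies this principle to the first one.\<close>

lemma rels0_toral_commute_inv: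
  assumes "i \<in> {1..m+n}" and "j \<in> {1..m+n}"
  shows "cong_ideal rels0 (Kinv i * K j) (K j * Kinv i)"
    and "cong_ideal rels0 (Kinv i * Kinv j) (Kinv j * Kinv i)"
proof -
  have *: "cong_ideal rels0 (Kinv i * x) (x * Kinv i)"
    if i: "i \<in> {1..m+n}" and x: "cong_ideal rels0 (K i * x) (x * K i)" for i x
  proof -
    have "cong_ideal rels0 (K i * x * Kinv i) (x * K i * Kinv i)"
      by (intro cong_ideal_mult x cong_span_refl)
    also have "cong_ideal rels0 (x * K i * Kinv i) (x * 1)"
      unfolding mult.assoc by (intro cong_ideal_mult rels0_toral_inverse i cong_span_refl)
    finally have "cong_ideal rels0 (K i * x * Kinv i) (1 \<cdot>\<^sub>f x)" by simp
    from cong_ideal_conj(2)[OF this] show ?thesis using rels0_toral_inverse[OF i] by simp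
  qed
  show 1: "cong_ideal rels0 (Kinv i * K j) (K j * Kinv i)"
    using assms by (intro * rels0_toral_commute)
  show "cong_ideal rels0 (Kinv i * Kinv j) (Kinv j * Kinv i)"
    using * [OF assms(2) cong_span_sym[OF 1]] by (rule cong_span_sym)
qed

lemma toral_K: "i \<in> {1..m+n} \<Longrightarrow> toral (toral_weight m (gK i)) (K i)"
  unfolding toral_def toral_gens_def
  using cong_ideal_conj(1)[OF rels0_toral_E rels0_toral_inverse(2,1)]
    cong_ideal_conj(1)[OF rels0_toral_F rels0_toral_inverse(2,1)]
  by (auto intro: rels0_toral_commute cong_span_sym[OF rels0_toral_commute_inv(1)]
      simp del: toral_weight.simps)

lemma toral_Kinv: "i \<in> {1..m+n} \<Longrightarrow> toral (toral_weight m (gKinv i)) (Kinv i)"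
  unfolding toral_def toral_gens_def
  using cong_ideal_conj(2)[OF rels0_toral_E rels0_toral_inverse(2,1)]
    cong_ideal_conj(2)[OF rels0_toral_F rels0_toral_inverse(2,1)]
  by (auto intro: rels0_toral_commute_inv)

lemma toral_mult:
  assumes "toral c t" and "toral d u"
  shows "toral (\<lambda>l. c l * d l) (t * u)"
proof -
  have *: "cong_ideal rels0 (t * u * x) ((a * b) \<cdot>\<^sub>f (x * (t * u)))"
    if "cong_ideal rels0 (t * x) (a \<cdot>\<^sub>f (x * t))" and "cong_ideal rels0 (u * x) (b \<cdot>\<^sub>f (x * u))" for a b x
  proof -
    have "cong_ideal rels0 (t * (u * x)) (t * (b \<cdot>\<^sub>f (x * u)))"
      by (intro cong_ideal_mult that cong_span_refl)
    also have "t * (b \<cdot>\<^sub>f (x * u)) = b \<cdot>\<^sub>f (t * x * u)" by (simp add: mult.assoc)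
    also have "cong_ideal rels0 \<dots> (b \<cdot>\<^sub>f (a \<cdot>\<^sub>f (x * t) * u))"
      by (intro cong_ideal_mult cong_ideal_scale that cong_span_refl)
    finally show ?thesis by (simp add: mult_ac)
  qed
  show ?thesis
    using assms *[of _ 1 1] by (auto simp: toral_def inverse_mult_distrib intro!: *)
qed

lemma toral_plus: "i \<in> {1..<m+n} \<Longrightarrow> toral (char_plus i) (toral_plus i)"
  unfolding char_plus_def[abs_def] toral_plus_def
  by (intro toral_mult toral_K toral_Kinv) auto

lemma toral_minus: "i \<in> {1..<m+n} \<Longrightarrow> toral (char_minus i) (toral_minus i)"
  unfolding char_minus_def[abs_def] toral_minus_def
  by (intro toral_mult toral_K toral_Kinv) auto

lemma char_minus: "char_minus i = (\<lambda>l. inverse (char_plus i l))"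
  by (rule ext) (simp add: char_plus_def char_minus_def inverse_mult_distrib)

lemma cartan_char_inverse: "cartan_char m i c \<Longrightarrow> cartan_char m i (\<lambda>l. inverse (c l))"
  unfolding cartan_char_def by (elim exE conjE, rule_tac x="inverse u" in exI) (auto split: if_splits)

lemma cartan_char_plus:
  assumes "i \<ge> 1"
  shows "cartan_char m i (char_plus i)"
proof -
  have 1: "char_plus i j = 1" if "\<bar>int i - int j\<bar> > 1" for j
    using that by (auto simp: char_plus_def)
  have 2: "char_plus i i = qi m i * qi m (i + 1)" "char_plus i (i + 1) = inverse (qi m (i + 1))"
    "char_plus i (i - 1) = inverse (qi m i)"
    using assms by (auto simp: char_plus_def power_int_minus)
  show ?thesis
  \<comment> \<open>The parameters \<open>qi m i\<close> and \<open>qi m (i + 1)\<close> are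
    mutually inverse at the odd node, whose simple root is therefore isotropic, and equal
    elsewhere.\<close>
  proof (cases "i = m")
    case True
    then show ?thesis
      unfolding cartan_char_def using 1 2
      by (intro exI[of _ "inverse q"]) (simp add: qi_def)
  next
    case False
    then show ?thesis
      unfolding cartan_char_def using 1 2
      by (intro exI[of _ "qi m i"]) (auto simp: qi_def)
  qed
qed

lemma cartan_char_minus: "i \<ge> 1 \<Longrightarrow> cartan_char m i (char_minus i)"
  unfolding char_minus by (intro cartan_char_inverse cartan_char_plus)

section \<open>Operators of the generators on the tensor product\<close>

definition toral_op :: "(nat \<Rightarrow> 'f poly fract) \<Rightarrow> 'f qfree \<Rightarrow> ('f poly fract, nat, qgen) tensor
    \<Rightarrow> ('f poly fract, nat, qgen) tensor" where
  "toral_op c t = tensor_op (twist (\<lambda>l. inverse (c l))) t"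

definition lowering :: "nat \<Rightarrow> (nat \<Rightarrow> 'f poly fract) \<Rightarrow> 'f lfree \<Rightarrow> 'f lfree" where
  "lowering i c f = coroot_factor i \<cdot>\<^sub>f skew_deriv (parity m i) c i f"

text \<open>\<open>toral_plus i\<close> is paired with \<open>char_minus i\<close>, since it has to
  pass the remaining F letters, whose weights are inverse to those of the E letters.\<close>

definition E_op :: "nat \<Rightarrow> ('f poly fract, nat, qgen) tensor \<Rightarrow> ('f poly fract, nat, qgen) tensor" where
  "E_op i x = tensor_op (twist (parity m i)) (even_E i) x
     + (tensor_op (lowering i (char_minus i)) (toral_plus i) x
        - tensor_op (lowering i (char_plus i)) (toral_minus i) x)"

fun gen_op :: "qgen \<Rightarrow> ('f poly fract, nat, qgen) tensor \<Rightarrow> ('f poly fract, nat, qgen) tensor" where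
  "gen_op (gE i) x = E_op i x"
| "gen_op (gF i) x = left (gen i) * x"
| "gen_op (gK i) x = toral_op (toral_weight m (gK i)) (K i) x"
| "gen_op (gKinv i) x = toral_op (toral_weight m (gKinv i)) (Kinv i) x"

lemma linear_map_lowering: "linear_map (lowering i c)"
  unfolding lowering_def[abs_def] by (intro linear_map_scale linear_map_skew_deriv)

lemma additive_toral_op: "additive (toral_op c t)"
  unfolding toral_op_def by (rule additive_tensor_op)

lemma additive_E_op: "additive (E_op i)"
  by standard (simp add: E_op_def additive.add[OF additive_tensor_op])

lemma additive_gen_op: "additive (gen_op g)"
  by (cases g; standard) (simp_all add: additive.add[OF additive_E_op]
      additive.add[OF additive_toral_op] distrib_left)

lemma toral_op_tensor:
  "toral_op c t (left f * const a) = left (twist (\<lambda>l. inverse (c l)) f) * const (t * a)"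
  unfolding toral_op_def by (rule tensor_op_tensor[OF linear_map_twist])

lemma E_op_tensor:
  "E_op i (left f * const a) = left (twist (parity m i) f) * const (even_E i * a)
     + (left (lowering i (char_minus i) f) * const (toral_plus i * a)
        - left (lowering i (char_plus i) f) * const (toral_minus i * a))"
  by (simp only: E_op_def tensor_op_tensor[OF linear_map_twist] tensor_op_tensor[OF linear_map_lowering])

lemma lowering_mult:
  "lowering i c (f * g) = twist (parity m i) f * lowering i c g + lowering i c f * twist c g"
  by (simp add: lowering_def skew_deriv_mult scale_distrib)

lemma toral_op_left: "toral_op c t (left f * x) = left (twist (\<lambda>l. inverse (c l)) f) * toral_op c t x"
proof (induction x rule: tensor_induct)
  case (tensor g a)
  show ?case
    using toral_op_tensor[of c t "f * g" a] toral_op_tensor[of c t g a]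
    by (simp add: left_mult mult.assoc twist_simps)
qed (simp add: distrib_left additive.add[OF additive_toral_op])

text \<open>An exchange rule for an arbitrary left factor, used twice: for \<open>f\<close> in
  \<open>J\<close> it shows that the submodule \<open>N\<close> is stable, and for a single letter
  it becomes (R3).\<close>

lemma E_op_left:
  "E_op i (left f * x) = left (twist (parity m i) f) * E_op i x
     + (left (lowering i (char_minus i) f) * toral_op (char_plus i) (toral_plus i) x
        - left (lowering i (char_plus i) f) * toral_op (char_minus i) (toral_minus i) x)"
proof (induction x rule: tensor_induct)
  case (tensor g a)
  have *: "left f * (left g * const a) = left (f * g) * const a"
    by (simp add: left_mult mult.assoc)
  have "inverse (char_minus i l) = char_plus i l" "inverse (char_plus i l) = char_minus i l" for l
    by (simp_all add: char_minus)
  then show ?case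
    unfolding * E_op_tensor toral_op_tensor
    by (simp add: left_mult mult.assoc twist_simps lowering_mult left_add algebra_simps)
qed (simp add: distrib_left additive.add[OF additive_toral_op] additive.add[OF additive_E_op])

lemma toral_op_toral_op:
  "toral_op c t (toral_op d u x) = toral_op (\<lambda>l. c l * d l) (t * u) x"
  by (induction x rule: tensor_induct)
    (simp_all add: toral_op_tensor twist_twist mult.assoc additive.add[OF additive_toral_op])

text \<open>Spans J \<otimes> A + T \<otimes> I, with I the ideal of the even relations: the kernel
  of the map onto the tensor product of the two quotients.\<close>

definition base_rels :: "('f poly fract, nat, qgen) tensor set" where
  "base_rels = {left j * x | j x. j \<in> J} \<union> {left f * const a | f a. a \<in> ideal_span rels0}"

abbreviation N :: "('f poly fract, nat, qgen) tensor set" where "N \<equiv> additive_span base_rels"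

abbreviation cong_N :: "('f poly fract, nat, qgen) tensor \<Rightarrow> ('f poly fract, nat, qgen) tensor \<Rightarrow> bool"
  where "cong_N \<equiv> cong_span base_rels"

lemma N_J: "j \<in> J \<Longrightarrow> left j * x \<in> N"
  by (rule additive_span.base) (auto simp: base_rels_def)

lemma N_rels0: "a \<in> ideal_span rels0 \<Longrightarrow> left f * const a \<in> N"
  by (rule additive_span.base) (auto simp: base_rels_def)

lemma N_image:
  assumes "additive h" and "\<And>j x. j \<in> J \<Longrightarrow> h (left j * x) \<in> additive_span S"
    and "\<And>f a. a \<in> ideal_span rels0 \<Longrightarrow> h (left f * const a) \<in> additive_span S" and "x \<in> N"
  shows "h x \<in> additive_span S"
  using assms(1) _ assms(4) by (rule additive_span_image) (auto simp: base_rels_def assms(2,3))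

lemma N_left: "x \<in> N \<Longrightarrow> left f * x \<in> N"
proof (erule N_image[OF additive_mult_left, rotated 2])
  show "left f * (left j * x) \<in> N" if "j \<in> J" for j x
    unfolding mult.assoc[symmetric] left_mult[symmetric]
    using that by (intro N_J ideal_span_mult_left)
  show "left f * (left g * const a) \<in> N" if "a \<in> ideal_span rels0" for g a
    unfolding mult.assoc[symmetric] left_mult[symmetric]
    using that by (rule N_rels0)
qed

lemma N_toral_op: "x \<in> N \<Longrightarrow> toral_op c t x \<in> N"
proof (erule N_image[OF additive_toral_op, rotated 2])
  show "toral_op c t (left j * x) \<in> N" if "j \<in> J" for j x
    unfolding toral_op_left using that by (intro N_J ideal_span_twist_serre)
  show "toral_op c t (left g * const a) \<in> N" if "a \<in> ideal_span rels0" for g a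
    unfolding toral_op_tensor using that by (intro N_rels0 ideal_span_mult_left)
qed

text \<open>The point at which stability of the Serre ideal under skew derivations enters; out of
  range the coroot factor is zero.\<close>

lemma lowering_J:
  assumes "j \<in> J" and "c = char_plus i \<or> c = char_minus i"
  shows "lowering i c j \<in> J"
proof (cases "i \<in> {1..<m+n}")
  case True
  then show ?thesis
    unfolding lowering_def using assms
    by (intro ideal_span_scale ideal_span_skew_deriv_serre) (auto intro: cartan_char_plus cartan_char_minus)
next
  case False
  then show ?thesis by (auto simp: lowering_def coroot_factor_def additive_span.zero)
qed

lemma N_E_op: "x \<in> N \<Longrightarrow> E_op i x \<in> N"
proof (erule N_image[OF additive_E_op, rotated 2])
  show "E_op i (left j * x) \<in> N" if "j \<in> J" for j x
    unfolding E_op_left using that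
    by (intro additive_span.add additive_span_diff N_J ideal_span_twist_serre lowering_J) auto
  show "E_op i (left g * const a) \<in> N" if "a \<in> ideal_span rels0" for g a
    unfolding E_op_tensor using that
    by (intro additive_span.add additive_span_diff N_rels0 ideal_span_mult_left)
qed

lemma N_gen_op: "x \<in> N \<Longrightarrow> gen_op g x \<in> N"
  by (cases g) (simp_all add: N_E_op N_toral_op N_left)

lemma cong_N_left: "cong_N x y \<Longrightarrow> cong_N (left f * x) (left f * y)"
  by (rule cong_span_map[OF additive_mult_left N_left])

lemma cong_N_E_op: "cong_N x y \<Longrightarrow> cong_N (E_op i x) (E_op i y)"
  by (rule cong_span_map[OF additive_E_op N_E_op])

lemma cong_N_const: "cong_ideal rels0 a b \<Longrightarrow> cong_N (left f * const a) (left f * const b)"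
  by (simp add: cong_span_def N_rels0 flip: right_diff_distrib single_diff)

lemma cong_N_toral_element:
  assumes "cong_ideal rels0 t u"
  shows "cong_N (toral_op c t x) (toral_op c u x)"
proof (induction x rule: tensor_induct)
  case (tensor f a)
  show ?case
    unfolding toral_op_tensor by (intro cong_N_const cong_ideal_mult assms cong_span_refl)
qed (simp add: additive.add[OF additive_toral_op] cong_span_add)

lemma toral_op_one: "toral_op (\<lambda>_. 1) 1 x = x"
  by (induction x rule: tensor_induct)
    (simp_all add: toral_op_tensor twist_trivial additive.add[OF additive_toral_op])

text \<open>The scalar \<open>c i\<close> arises in two ways: in the first summand from exchanging
  \<open>t\<close> with \<open>even_E i\<close>, in the others from the letter \<open>i\<close>
  removed by \<open>lowering\<close>, since \<open>t\<close> commutes with toral elements.\<close>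

lemma toral_op_E_op:
  assumes t: "toral c t"
  shows "cong_N (toral_op c t (E_op i x)) (left (const (c i)) * E_op i (toral_op c t x))"
proof (cases "i \<in> {1..<m+n}")
  case False
  then have "even_E i = 0" "lowering i d f = 0" for d f
    by (auto simp: even_E_def lowering_def coroot_factor_def)
  then have "E_op i x = 0" for x
    by (induction x rule: tensor_induct)
      (simp_all add: E_op_tensor additive.add[OF additive_E_op] additive.zero[OF additive_left])
  then show ?thesis by (simp add: additive.zero[OF additive_toral_op])
next
  case i: True
  show ?thesis
  proof (induction x rule: tensor_induct)
    case (tensor f a)
    let ?tw = "twist (\<lambda>l. inverse (c l))"
    have c: "c i \<noteq> 0" using t by (simp add: toral_def)
    have comm: "cong_ideal rels0 (t * gen g) (gen g * t)" if "g \<in> toral_gens" for g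
      using t that by (simp add: toral_def)
    have prod: "cong_ideal rels0 (t * (gen g * gen h * a)) (gen g * gen h * (t * a))"
      if "g \<in> toral_gens" "h \<in> toral_gens" for g h
    proof -
      have "cong_ideal rels0 (t * gen g * (gen h * a)) (gen g * t * (gen h * a))"
        by (intro cong_ideal_mult comm that cong_span_refl)
      also have "gen g * t * (gen h * a) = gen g * ((t * gen h) * a)" by (simp add: mult.assoc)
      also have "cong_ideal rels0 \<dots> (gen g * ((gen h * t) * a))"
        by (intro cong_ideal_mult comm that cong_span_refl)
      finally show ?thesis by (simp add: mult.assoc)
    qed
    have plus: "cong_ideal rels0 (t * (toral_plus i * a)) (toral_plus i * (t * a))"
      and minus: "cong_ideal rels0 (t * (toral_minus i * a)) (toral_minus i * (t * a))"
      unfolding toral_plus_def toral_minus_def using i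
      by (auto intro!: prod simp: toral_gens_def)
    have "cong_ideal rels0 (t * even_E i * a) (c i \<cdot>\<^sub>f (even_E i * t) * a)"
      using t by (intro cong_ideal_mult cong_span_refl) (simp add: toral_def)
    then have E: "cong_ideal rels0 (t * (even_E i * a)) (c i \<cdot>\<^sub>f (even_E i * (t * a)))"
      by (simp add: mult.assoc)
    have low: "lowering i d (?tw f) = inverse (c i) \<cdot>\<^sub>f ?tw (lowering i d f)" for d
      by (simp add: lowering_def skew_deriv_twist twist_simps mult.commute)
    have tw: "twist (parity m i) (?tw f) = ?tw (twist (parity m i) f)"
      by (simp add: twist_twist mult.commute)
    have sc: "left (const k) * (left g * const b) = left (k \<cdot>\<^sub>f g) * const b" for k g and b :: "'f qfree"
      by (simp add: scale_def left_mult mult.assoc)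
    have 1: "toral_op c t (E_op i (left f * const a)) =
       left (?tw (twist (parity m i) f)) * const (t * (even_E i * a))
        + (left (?tw (lowering i (char_minus i) f)) * const (t * (toral_plus i * a))
        - left (?tw (lowering i (char_plus i) f)) * const (t * (toral_minus i * a)))"
      unfolding E_op_tensor
      by (simp only: additive.add[OF additive_toral_op] additive.diff[OF additive_toral_op] toral_op_tensor)
    have 2: "cong_N (left (?tw (twist (parity m i) f)) * const (t * (even_E i * a))
        + (left (?tw (lowering i (char_minus i) f)) * const (t * (toral_plus i * a))
        - left (?tw (lowering i (char_plus i) f)) * const (t * (toral_minus i * a))))
       (left (?tw (twist (parity m i) f)) * const (c i \<cdot>\<^sub>f (even_E i * (t * a)))
        + (left (?tw (lowering i (char_minus i) f)) * const (toral_plus i * (t * a))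
        - left (?tw (lowering i (char_plus i) f)) * const (toral_minus i * (t * a))))"
      by (rule cong_span_add[OF cong_N_const[OF E]
            cong_span_diff[OF cong_N_const[OF plus] cong_N_const[OF minus]]])
    have 3: "left (const (c i)) * E_op i (toral_op c t (left f * const a)) =
       left (?tw (twist (parity m i) f)) * const (c i \<cdot>\<^sub>f (even_E i * (t * a)))
        + (left (?tw (lowering i (char_minus i) f)) * const (toral_plus i * (t * a))
        - left (?tw (lowering i (char_plus i) f)) * const (toral_minus i * (t * a)))"
      by (simp only: toral_op_tensor E_op_tensor distrib_left right_diff_distrib sc tw low
          scale_scale right_inverse[OF c] scale_one left_scale)
    show ?case unfolding 1 3 by (rule 2)
  next
    case (add x y)
    then show ?case
      by (simp add: additive.add[OF additive_toral_op] additive.add[OF additive_E_op]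
          distrib_left cong_span_add)
  qed
qed

section \<open>The free algebra acting on the tensor product\<close>

definition act :: "'f qfree \<Rightarrow> ('f poly fract, nat, qgen) tensor \<Rightarrow> ('f poly fract, nat, qgen) tensor" where
  "act x v = additive_ext (\<lambda>w c. left (const c) * foldr gen_op (letters w) v) x"

lemma additive_act_summand: "additive (\<lambda>c. left (const c) * (y :: ('f poly fract, nat, qgen) tensor))"
  by standard (simp add: single_add left_add distrib_right)

lemma additive_act: "additive (\<lambda>x. act x v)"
  unfolding act_def by (intro additive_additive_ext additive_act_summand)

lemmas act_add = additive.add[OF additive_act]
lemmas act_diff = additive.diff[OF additive_act]

lemma act_single: "act (Poly_Mapping.single w c) v = left (const c) * foldr gen_op (letters w) v"
  unfolding act_def by (rule additive_ext_single[OF additive_act_summand])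

lemma act_const: "act (const c) v = left (const c) * v"
  by (simp add: act_single zero_word_def)

lemma gen_op_scalar: "gen_op g (left (const c) * v) = left (const c) * gen_op g v"
proof (cases g)
  case (gF i)
  then show ?thesis
    by (simp add: mult.assoc[symmetric] left_mult[symmetric] const_central)
qed (simp_all add: toral_op_left E_op_left twist_simps lowering_def skew_deriv_const
      additive.zero[OF additive_left])

lemma act_gen_mult: "act (gen g * x) v = gen_op g (act x v)"
proof (induction x rule: poly_mapping_additive_induct)
  case (single w c)
  have "act (gen g * Poly_Mapping.single (Word u) c) v =
      gen_op g (act (Poly_Mapping.single (Word u) c) v)" for u
    by (simp add: act_single gen_op_scalar flip: single_Word_Cons)
  from this[of "letters w"] show ?case by simp
qed (simp add: distrib_left act_add additive.add[OF additive_gen_op])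

lemma act_scale: "act (c \<cdot>\<^sub>f x) v = left (const c) * act x v"
  by (induction x rule: poly_mapping_additive_induct)
    (simp_all add: scale_single act_single mult.assoc[symmetric] left_mult[symmetric] mult_single
      scale_distrib act_add distrib_left)

lemma act_mult: "act (x * y) v = act x (act y v)"
  by (induction x rule: free_induct)
    (simp_all add: act_const act_scale act_gen_mult mult.assoc distrib_right act_add flip: scale_def)

lemma act_one: "act 1 v = v"
  using act_const[of 1 v] by simp

lemma act_gen: "act (gen g) v = gen_op g v"
  using act_gen_mult[of g 1 v] by (simp add: act_one)

lemma additive_act_right: "additive (act x)"
proof
  show "act x (v + w) = act x v + act x w" for v w
    by (induction x rule: free_induct)
      (simp_all add: act_const act_gen_mult act_add distrib_left additive.add[OF additive_gen_op])
qed

lemma N_act: "v \<in> N \<Longrightarrow> act x v \<in> N"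
  by (induction x rule: free_induct)
    (simp_all add: act_const act_gen_mult act_add N_left N_gen_op additive_span.add)

section \<open>Words in the E letters acting on the module\<close>

abbreviation E_hom :: "'f lfree \<Rightarrow> 'f qfree" where "E_hom \<equiv> lift E"
abbreviation F_hom :: "'f lfree \<Rightarrow> 'f qfree" where "F_hom \<equiv> lift F"

lemma act_F_hom: "act (F_hom s) v = left s * v"
  by (induction s rule: free_induct)
    (simp_all add: lift_simps act_const act_gen_mult act_add left_add left_mult distrib_right mult.assoc)

lemma act_E_gen_mult: "act (E_hom (gen l * s)) v = E_op l (act (E_hom s) v)"
  by (simp add: lift_simps act_gen_mult)

lemma toral_op_act_E:
  assumes t: "toral c t"
  shows "cong_N (toral_op c t (act (E_hom s) x)) (act (E_hom (twist c s)) (toral_op c t x))"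
proof (induction s rule: free_induct)
  case (const k)
  show ?case by (simp add: lift_simps twist_simps act_const toral_op_left)
next
  case (gen l s)
  have "cong_N (toral_op c t (E_op l (act (E_hom s) x)))
      (left (const (c l)) * E_op l (toral_op c t (act (E_hom s) x)))"
    by (rule toral_op_E_op[OF t])
  also have "cong_N \<dots> (left (const (c l)) * E_op l (act (E_hom (twist c s)) (toral_op c t x)))"
    by (rule cong_N_left[OF cong_N_E_op[OF gen]])
  also have "\<dots> = act (E_hom (twist c (gen l * s))) (toral_op c t x)"
    by (simp add: twist_simps lift_simps act_scale act_gen_mult)
  finally show ?case by (simp only: act_E_gen_mult)
next
  case (add s s')
  then show ?case
    by (simp add: lift_simps twist_simps act_add additive.add[OF additive_toral_op] cong_span_add)
qed

lemma parity_sq [simp]: "parity m i j * parity m i j = (1 :: 'f poly fract)"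
  by (simp add: parity_def)

lemma parity_sym: "parity m i j = (parity m j i :: 'f poly fract)"
  by (auto simp: parity_def)

lemma scalar_scalar: "left (const c) * (left (const d) * v) = left (const (c * d)) * v"
  by (simp add: mult.assoc[symmetric] left_mult[symmetric] mult_single)

lemma scalar_left: "left f * (left (const c) * v) = left (const c) * (left f * v)"
  by (simp add: mult.assoc[symmetric] left_mult[symmetric] const_central)

lemma E_op_scalar: "E_op i (left (const c) * v) = left (const c) * E_op i v"
  using gen_op_scalar[of "gE i"] by simp

lemma lowering_gen: "lowering i c (gen j) = (if j = i then const (coroot_factor i) else 0)"
  by (simp add: lowering_def skew_deriv_gen scale_def)

text \<open>This is (R3) as an identity of operators, exact and not only modulo \<open>N\<close>;
  the coefficients in \<open>E_op\<close> are made for it.\<close>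

lemma E_op_F:
  "E_op l (left (gen j) * x) = left (const (parity m l j)) * (left (gen j) * E_op l x)
     + (if l = j then left (const (coroot_factor j)) *
         (toral_op (char_plus j) (toral_plus j) x - toral_op (char_minus j) (toral_minus j) x) else 0)"
  by (auto simp: E_op_left lowering_gen twist_simps additive.zero[OF additive_left]
      right_diff_distrib scale_def left_mult mult.assoc)

text \<open>In range \<open>t\<close> is toral and \<open>toral_op_act_E\<close> applies; out of
  range the scalar factor is zero.\<close>

lemma coroot_toral_op_act_E:
  assumes "(c, t) = (char_plus j, toral_plus j) \<or> (c, t) = (char_minus j, toral_minus j)"
  shows "cong_N (left (const (coroot_factor j)) * toral_op c t (act (E_hom s) x))
     (left (const (coroot_factor j)) * act (E_hom (twist c s)) (toral_op c t x))"
proof (cases "j \<in> {1..<m+n}")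
  case True
  then have "toral c t" using assms toral_plus toral_minus by auto
  then show ?thesis by (intro cong_N_left toral_op_act_E)
next
  case False
  then have "coroot_factor j = 0" by (auto simp: coroot_factor_def)
  then show ?thesis by (simp add: additive.zero[OF additive_left])
qed

lemma lowering_gen_mult:
  "lowering i c (gen j * f) = parity m i j \<cdot>\<^sub>f (gen j * lowering i c f)
     + (if j = i then coroot_factor i \<cdot>\<^sub>f twist c f else 0)"
  by (simp add: lowering_def skew_deriv_gen_mult scale_distrib mult.commute)

lemma lowering_add: "lowering i c (f + g) = lowering i c f + lowering i c g"
  by (simp add: lowering_def skew_deriv_add scale_distrib)

lemma lowering_const: "lowering i c (const a) = 0"
  by (simp add: lowering_def skew_deriv_const)

text \<open>Moving \<open>F\<^sub>j\<close> to the left through a word \<open>s\<close> in the \<open>E\<^sub>i\<close> produces the same skew derivations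
  of \<open>s\<close> as those by which \<open>E\<^sub>j\<close> acts on words in the \<open>F\<^sub>i\<close>.\<close>

lemma act_E_F:
  "cong_N (act (E_hom (twist (parity m j) s)) (left (gen j) * x))
     (left (gen j) * act (E_hom s) x + left (const (parity m j j)) *
       (act (E_hom (lowering j (char_plus j) s)) (toral_op (char_plus j) (toral_plus j) x)
        - act (E_hom (lowering j (char_minus j) s)) (toral_op (char_minus j) (toral_minus j) x)))"
proof (induction s rule: free_induct)
  case (const k)
  show ?case
    by (simp add: twist_simps lift_simps act_const lowering_const scalar_left
        additive.zero[OF additive_act])
next
  case (gen l s)
  define A where "A = act (E_hom s) x"
  define p m' where pm: "p = toral_op (char_plus j) (toral_plus j) x"
    "m' = toral_op (char_minus j) (toral_minus j) x"
  define P M where PM: "P = act (E_hom (lowering j (char_plus j) s)) p"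
    "M = act (E_hom (lowering j (char_minus j) s)) m'"
  define P' M' where PM': "P' = act (E_hom (twist (char_plus j) s)) p"
    "M' = act (E_hom (twist (char_minus j) s)) m'"
  let ?g = "left (const (coroot_factor j))"
  let ?Y = "left (gen j) * A + left (const (parity m j j)) * (P - M)"
  have 1: "cong_N (left (const (parity m j l)) * E_op l (act (E_hom (twist (parity m j) s)) (left (gen j) * x)))
      (left (const (parity m j l)) * E_op l ?Y)"
    using gen unfolding A_def pm PM by (intro cong_N_left cong_N_E_op)
  have 2: "act (E_hom (twist (parity m j) (gen l * s))) (left (gen j) * x) =
      left (const (parity m j l)) * E_op l (act (E_hom (twist (parity m j) s)) (left (gen j) * x))"
    by (simp add: twist_simps lift_simps act_scale act_gen_mult)
  have 3: "left (const (parity m j l)) * E_op l ?Y = left (gen j) * E_op l A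
     + left (const (parity m j l * parity m j j)) * (E_op l P - E_op l M)
     + left (const (parity m j l)) * (if l = j then
          ?g * toral_op (char_plus j) (toral_plus j) A - ?g * toral_op (char_minus j) (toral_minus j) A else 0)"
    by (simp add: additive.add[OF additive_E_op] additive.diff[OF additive_E_op] E_op_scalar E_op_F
        distrib_left scalar_scalar parity_sym[of l j] right_diff_distrib)
  \<comment> \<open>For \<open>l = j\<close>, (R3) leaves toral operators in front of the remaining
    word; moving them behind it twists the word by their characters, which is the second summand in
    the recursion of the skew derivative.\<close>
  have "cong_N (?g * toral_op (char_plus j) (toral_plus j) A) (?g * P')"
    "cong_N (?g * toral_op (char_minus j) (toral_minus j) A) (?g * M')"
    unfolding A_def PM' pm by (simp_all add: coroot_toral_op_act_E)
  then have 4: "cong_N (left (gen j) * E_op l A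
     + left (const (parity m j l * parity m j j)) * (E_op l P - E_op l M)
     + left (const (parity m j l)) * (if l = j then
          ?g * toral_op (char_plus j) (toral_plus j) A - ?g * toral_op (char_minus j) (toral_minus j) A else 0))
     (left (gen j) * E_op l A
     + left (const (parity m j l * parity m j j)) * (E_op l P - E_op l M)
     + left (const (parity m j l)) * (if l = j then ?g * P' - ?g * M' else 0))"
    by (cases "l = j") (simp_all add: cong_span_add cong_N_left cong_span_diff)
  have 5: "left (gen j) * act (E_hom (gen l * s)) x + left (const (parity m j j)) *
       (act (E_hom (lowering j (char_plus j) (gen l * s))) p
        - act (E_hom (lowering j (char_minus j) (gen l * s))) m') =
     left (gen j) * E_op l A
     + left (const (parity m j l * parity m j j)) * (E_op l P - E_op l M)
     + left (const (parity m j l)) * (if l = j then ?g * P' - ?g * M' else 0)"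
    unfolding A_def PM PM'
    by (auto simp: lowering_gen_mult lift_simps act_add act_scale act_gen_mult additive.zero[OF additive_act]
        distrib_left right_diff_distrib scalar_scalar mult.commute)
  show ?case unfolding pm[symmetric] 2 5 by (rule cong_span_trans[OF 1[unfolded 3] 4])
next
  case (add s s')
  have 1: "act (E_hom (twist (parity m j) (s + s'))) (left (gen j) * x) =
      act (E_hom (twist (parity m j) s)) (left (gen j) * x)
      + act (E_hom (twist (parity m j) s')) (left (gen j) * x)"
    by (simp add: twist_simps lift_simps act_add)
  have 2: "a * (b + b') + c * ((d + d') - (e + e')) = (a * b + c * (d - e)) + (a * b' + c * (d' - e'))"
    for a b b' c d d' e e' :: "('f poly fract, nat, qgen) tensor"
    by (simp add: algebra_simps)
  show ?case
    unfolding 1 lift_add lowering_add act_add 2 by (rule cong_span_add[OF add])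
qed

text \<open>\<open>lowering\<close> annihilates constants, so on 1 \<otimes> a each E letter acts by
  multiplication in the second factor, with \<open>E m\<close> acting as 0.\<close>

lemma act_E_base:
  "act (E_hom s) (left (const k) * const a) = left (const k) * const (lift even_E s * a)"
proof (induction s rule: free_induct)
  case (const c)
  have "left (c \<cdot>\<^sub>f const k) * const a = left (const k) * const (c \<cdot>\<^sub>f a)" by (rule left_scale)
  then show ?case by (simp add: lift_simps act_const scale_def left_mult mult.assoc)
next
  case (gen l s)
  then show ?case
    by (simp add: lift_simps act_gen_mult E_op_tensor twist_simps lowering_const
        additive.zero[OF additive_left] mult.assoc)
next
  case (add s s')
  then show ?case by (simp add: lift_simps act_add distrib_left distrib_right single_add)
qed

lemma rels0_memI:
  assumes "r \<in> R3 m n \<or> r \<in> R5 m n \<or> r \<in> R6 m n \<or> r \<in> R7 m n"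
    and "r \<in> carrier (free_alg (even_qgens m n))"
  shows "r \<in> ideal_span rels0"
  using assms by (intro ideal_span_superset rel0_mem) auto

text \<open>A Serre element involving the letter \<open>m\<close> contains it in every term and is
  sent to 0; the others become relations of the even algebra.\<close>

lemma lift_even_E_J: "s \<in> J \<Longrightarrow> lift even_E s \<in> ideal_span rels0"
proof (erule ideal_span_hom[OF additive_lift lift_mult, rotated])
  fix r :: "'f lfree" assume "r \<in> serre m n"
  then show "lift even_E r \<in> ideal_span rels0"
  proof cases
    case square
    then show ?thesis by (simp add: lift_simps even_E_def additive_span.zero)
  next
    case (commute i j)
    show ?thesis
    proof (cases "i = m \<or> j = m")
      case True
      then show ?thesis
        unfolding commute(1) by (auto simp: lift_simps even_E_def additive_span.zero)
    next
      case False
      have "E i * E j - E j * (E i :: 'f qfree) \<in> R5 m n"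
        unfolding R5_def using commute by blast
      then show ?thesis
        unfolding commute(1) using False commute
        by (simp add: lift_simps even_E_def rels0_memI free_alg_closed even_qgens_simps)
    qed
  next
    case (cubic i j)
    show ?thesis
    proof (cases "j = m")
      case True
      then show ?thesis
        unfolding cubic(1) by (auto simp: lift_simps even_E_def additive_span.zero)
    next
      case False
      have "E i * E i * E j - (q + inverse q) \<cdot>\<^sub>f (E i * E j * E i) + E j * E i * (E i :: 'f qfree) \<in> R6 m n"
        unfolding R6_def using cubic by blast
      then show ?thesis
        unfolding cubic(1) using False cubic
        by (simp add: lift_simps even_E_def rels0_memI free_alg_closed even_qgens_simps)
    qed
  next
    case odd
    then show ?thesis
      by (simp add: odd_serre_def Let_def lift_simps even_E_def additive_span.zero)
  qed
qed

lemma lift_even_F_J: "s \<in> J \<Longrightarrow> lift even_F s \<in> ideal_span rels0"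
proof (erule ideal_span_hom[OF additive_lift lift_mult, rotated])
  fix r :: "'f lfree" assume "r \<in> serre m n"
  then show "lift even_F r \<in> ideal_span rels0"
  proof cases
    case square
    then show ?thesis by (simp add: lift_simps even_F_def additive_span.zero)
  next
    case (commute i j)
    show ?thesis
    proof (cases "i = m \<or> j = m")
      case True
      then show ?thesis
        unfolding commute(1) by (auto simp: lift_simps even_F_def additive_span.zero)
    next
      case False
      have "F i * F j - F j * (F i :: 'f qfree) \<in> R5 m n"
        unfolding R5_def using commute by blast
      then show ?thesis
        unfolding commute(1) using False commute
        by (simp add: lift_simps even_F_def rels0_memI free_alg_closed even_qgens_simps)
    qed
  next
    case (cubic i j)
    show ?thesis
    proof (cases "j = m")
      case True
      then show ?thesis
        unfolding cubic(1) by (auto simp: lift_simps even_F_def additive_span.zero)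
    next
      case False
      have "F i * F i * F j - (q + inverse q) \<cdot>\<^sub>f (F i * F j * F i) + F j * F i * (F i :: 'f qfree) \<in> R7 m n"
        unfolding R7_def using cubic by blast
      then show ?thesis
        unfolding cubic(1) using False cubic
        by (simp add: lift_simps even_F_def rels0_memI free_alg_closed even_qgens_simps)
    qed
  next
    case odd
    then show ?thesis
      by (simp add: odd_serre_def Let_def lift_simps even_F_def additive_span.zero)
  qed
qed

lemma act_scalar: "act x (left (const c) * v) = left (const c) * act x v"
  by (induction x rule: free_induct)
    (simp_all add: act_const act_gen_mult gen_op_scalar act_add distrib_left scalar_scalar mult.commute)

text \<open>Induction on \<open>f\<close> for all \<open>s\<close> in \<open>J\<close>
  simultaneously: \<open>act_E_F\<close> extracts the first letter of \<open>f\<close>, and every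
  error term is again an element of \<open>J\<close> acting on the shorter word. Toral operators
  twist that word, so the claim is stated for \<open>twist d f\<close>.\<close>

lemma act_E_J_twist:
  assumes "s \<in> J"
  shows "act (E_hom s) (left (twist d f) * const a) \<in> N"
  using assms
proof (induction f arbitrary: s d a rule: free_induct)
  case (const k)
  then show ?case
    by (simp add: twist_simps act_E_base N_rels0 ideal_span_mult_right lift_even_E_J)
next
  case (gen j f)
  define x where "x = left (twist d f) * const a"
  \<comment> \<open>Chosen so that its parity twist is \<open>s\<close>, the twist being an
    involution; \<open>act_E_F\<close> expects this form.\<close>
  define s' where "s' = twist (parity m j) s"
  have J: "s' \<in> J" "s \<in> J" unfolding s'_def using gen.prems by (auto intro: ideal_span_twist_serre)
  have x: "act (E_hom s') x \<in> N"
    unfolding x_def using J(1) by (rule gen.IH)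
  have toral: "act (E_hom r) (toral_op c t x) \<in> N" if "r \<in> J" for r c t
    unfolding x_def toral_op_tensor twist_twist using that by (rule gen.IH)
  have "act (E_hom (twist (parity m j) s')) (left (gen j) * x) \<in> N"
    using J by (intro cong_span_mem[OF act_E_F] additive_span.add additive_span_diff N_left x toral lowering_J) auto
  moreover have "twist (parity m j) s' = s" by (simp add: s'_def twist_twist twist_trivial)
  moreover have "left (twist d (gen j * f)) * const a = left (const (d j)) * (left (gen j) * x)"
    by (simp add: x_def left_mult mult.assoc twist_simps scale_def)
  ultimately show ?case by (simp add: act_scalar N_left)
next
  case (add f g)
  then show ?case
    by (simp add: twist_simps left_add distrib_right additive.add[OF additive_act_right] additive_span.add)
qed

lemma act_E_J: "s \<in> J \<Longrightarrow> act (E_hom s) v \<in> N"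
proof (induction v rule: tensor_induct)
  case (tensor f a)
  then show ?case using act_E_J_twist[of s "\<lambda>_. 1" f a] by (simp add: twist_trivial)
qed (simp add: additive.add[OF additive_act_right] additive_span.add)

subsection \<open>The defining relations act trivially\<close>

text \<open>Decides which branch of \<open>super_comm\<close> is taken in (R8), where the first
  argument is not a letter.\<close>

definition homogeneous :: "bool \<Rightarrow> 'f qfree \<Rightarrow> bool" where
  "homogeneous b x \<longleftrightarrow>
    (\<forall>w\<in>Poly_Mapping.keys x. odd (length (filter (odd_gen m) (letters w))) = b)"

lemma homogeneous_gen: "homogeneous (odd_gen m g) (gen g)"
  by (simp add: homogeneous_def keys_gen)

lemma homogeneous_diff: "homogeneous b x \<Longrightarrow> homogeneous b y \<Longrightarrow> homogeneous b (x - y)"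
  using keys_diff[of x y] by (auto simp: homogeneous_def)

lemma homogeneous_mult:
  assumes "homogeneous a x" and "homogeneous b y"
  shows "homogeneous (a \<noteq> b) (x * y)"
  unfolding homogeneous_def
proof
  fix w assume "w \<in> Poly_Mapping.keys (x * y)"
  then obtain u v where "u \<in> Poly_Mapping.keys x" "v \<in> Poly_Mapping.keys y" "w = u + v"
    using keys_mult[of x y] by blast
  then show "odd (length (filter (odd_gen m) (letters w))) = (a \<noteq> b)"
    using assms by (auto simp: homogeneous_def plus_word_def)
qed

lemma homogeneous_scale: "homogeneous b x \<Longrightarrow> homogeneous b (c \<cdot>\<^sub>f x)"
  using homogeneous_mult[of False "const c" b x]
  by (simp add: scale_def homogeneous_def zero_word_def)

lemma odd_elem_homogeneous: "odd_elem m x \<longleftrightarrow> homogeneous True x"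
  by (simp add: odd_elem_def homogeneous_def)

lemma super_comm_Eroot:
  "super_comm m (Eroot m (m - 1) (m + 2)) (E m) = E_hom (odd_serre m)"
proof -
  obtain k where k: "m = Suc k" using m_pos by (cases m) auto
  have g: "homogeneous False (E k)" "homogeneous True (E m)" "homogeneous False (E (Suc m))"
    using homogeneous_gen[of "gE k"] homogeneous_gen[of "gE m"] homogeneous_gen[of "gE (Suc m)"] k
    by simp_all
  define x where "x = E k * E m - inverse q \<cdot>\<^sub>f (E m * (E k :: 'f qfree))"
  have x: "Eroot m (m - 1) (m + 1) = x"
    using k by (simp add: x_def qi_def)
  have y: "Eroot m (m - 1) (m + 2) = x * E (m + 1) - q \<cdot>\<^sub>f (E (m + 1) * x)"
    using k x by (simp add: qi_def)
  have "homogeneous True x"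
    unfolding x_def using homogeneous_mult[OF g(1,2)] homogeneous_mult[OF g(2,1)]
    by (intro homogeneous_diff homogeneous_scale) simp_all
  then have "homogeneous True (x * E (m + 1) - q \<cdot>\<^sub>f (E (m + 1) * x))"
    using homogeneous_mult[OF _ g(3), of True x] homogeneous_mult[OF g(3), of True x]
    by (intro homogeneous_diff homogeneous_scale) simp_all
  then show ?thesis
    unfolding super_comm_def odd_elem_homogeneous y using g(2)
    by (simp add: odd_serre_def Let_def lift_simps x_def k)
qed

text \<open>F_(m-1,m+1) is \<open>- q\<close> times the analogue of E_(m-1,m+1). This scalar makes
  up for the other normalisation of the next step, so F_(m-1,m+2) is the same expression in the
  letters as E_(m-1,m+2).\<close>

lemma super_comm_Froot:
  "super_comm m (Froot m (m - 1) (m + 2)) (F m) = F_hom (odd_serre m)"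
proof -
  obtain k where k: "m = Suc k" using m_pos by (cases m) auto
  have g: "homogeneous False (F k)" "homogeneous True (F m)" "homogeneous False (F (Suc m))"
    using homogeneous_gen[of "gF k"] homogeneous_gen[of "gF m"] homogeneous_gen[of "gF (Suc m)"] k
    by simp_all
  define x where "x = F k * F m - inverse q \<cdot>\<^sub>f (F m * (F k :: 'f qfree))"
  have x: "Froot m (m - 1) (m + 1) = - (q \<cdot>\<^sub>f x)"
    using k by (simp add: x_def qi_def scale_distrib)
  have y: "Froot m (m - 1) (m + 2) = x * F (m + 1) - q \<cdot>\<^sub>f (F (m + 1) * x)"
    using k x by (simp add: qi_def scale_minus)
  have "homogeneous True x"
    unfolding x_def using homogeneous_mult[OF g(1,2)] homogeneous_mult[OF g(2,1)]
    by (intro homogeneous_diff homogeneous_scale) simp_all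
  then have "homogeneous True (x * F (m + 1) - q \<cdot>\<^sub>f (F (m + 1) * x))"
    using homogeneous_mult[OF _ g(3), of True x] homogeneous_mult[OF g(3), of True x]
    by (intro homogeneous_diff homogeneous_scale) simp_all
  then show ?thesis
    unfolding super_comm_def odd_elem_homogeneous y using g(2)
    by (simp add: odd_serre_def Let_def lift_simps x_def k)
qed

text \<open>Leaves two kinds of relations: those in (R1)-(R3), checked directly on operators, and
  images of Serre elements, for which \<open>act_E_J\<close> and left multiplication by
  \<open>J\<close> apply.\<close>

lemma Uq_rels_serre:
  assumes "r \<in> (Uq_rels m n :: 'f qfree set)"
  shows "r \<in> R1 m n \<union> R2 m n \<union> R3 m n \<union> E_hom ` serre m n \<union> F_hom ` serre m n"
proof -
  have 4: "R4 m \<subseteq> E_hom ` serre m n \<union> F_hom ` serre m n"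
    using imageI[OF serre.square[of m n], of E_hom] imageI[OF serre.square[of m n], of F_hom]
    by (auto simp: R4_def lift_simps)
  have 5: "R5 m n \<subseteq> E_hom ` serre m n \<union> F_hom ` serre m n"
  proof -
    have "E i * E j - E j * E i \<in> E_hom ` serre m n" "F i * F j - F j * F i \<in> F_hom ` serre m n"
      if "i \<in> {1..<m+n}" "j \<in> {1..<m+n}" "\<bar>int i - int j\<bar> > 1" for i j
      using imageI[OF serre.commute[OF that], of E_hom] imageI[OF serre.commute[OF that], of F_hom]
      by (simp_all add: lift_simps)
    then show ?thesis unfolding R5_def by blast
  qed
  have 67: "R6 m n \<subseteq> E_hom ` serre m n" "R7 m n \<subseteq> F_hom ` serre m n"
  proof -
    have "E i * E i * E j - (q + inverse q) \<cdot>\<^sub>f (E i * E j * E i) + E j * E i * E i \<in> E_hom ` serre m n"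
        "F i * F i * F j - (q + inverse q) \<cdot>\<^sub>f (F i * F j * F i) + F j * F i * F i \<in> F_hom ` serre m n"
      if "i \<in> {1..<m+n}" "j \<in> {1..<m+n}" "\<bar>int i - int j\<bar> = 1" "i \<noteq> m" for i j
      using imageI[OF serre.cubic[OF that], of E_hom] imageI[OF serre.cubic[OF that], of F_hom]
      by (simp_all add: lift_simps)
    then show "R6 m n \<subseteq> E_hom ` serre m n" "R7 m n \<subseteq> F_hom ` serre m n"
      unfolding R6_def R7_def by blast+
  qed
  have 8: "R8 m n \<subseteq> E_hom ` serre m n \<union> F_hom ` serre m n"
  proof (cases "m \<ge> 2 \<and> n \<ge> 2")
    case True
    then have "R8 m n = {E_hom (odd_serre m), F_hom (odd_serre m)}"
      by (simp only: R8_def simp_thms if_True super_comm_Eroot super_comm_Froot)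
    then show ?thesis using serre.odd True by blast
  next
    case False
    then show ?thesis by (simp only: R8_def if_False) blast
  qed
  show ?thesis using assms 4 5 67 8 unfolding Uq_rels_def by blast
qed

lemma act_toral:
  "act (K i) v = toral_op (toral_weight m (gK i)) (K i) v"
  "act (Kinv i) v = toral_op (toral_weight m (gKinv i)) (Kinv i) v"
  "act (E i) v = E_op i v" "act (F i) v = left (gen i) * v"
  by (simp_all add: act_gen)

lemma toral_op_inverse:
  assumes "i \<in> {1..m+n}"
  shows "cong_N (toral_op (toral_weight m (gK i)) (K i) (toral_op (toral_weight m (gKinv i)) (Kinv i) v)) v"
    and "cong_N (toral_op (toral_weight m (gKinv i)) (Kinv i) (toral_op (toral_weight m (gK i)) (K i) v)) v"
  using cong_N_toral_element[OF rels0_toral_inverse(1)[OF assms], of "\<lambda>_. 1" v]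
    cong_N_toral_element[OF rels0_toral_inverse(2)[OF assms], of "\<lambda>_. 1" v]
  by (simp_all add: toral_op_toral_op toral_op_one)

lemma act_R1:
  assumes "r \<in> R1 m n"
  shows "act r v \<in> N"
proof -
  have commute: "act (K i * K j - K j * K i) v \<in> N" if "i \<in> {1..m+n}" "j \<in> {1..m+n}" for i j
    using cong_N_toral_element[OF rels0_toral_commute[OF that]]
    by (simp add: act_diff act_mult act_toral toral_op_toral_op mult.commute[of "toral_weight m (gK j) _"]
        cong_span_def[symmetric] del: toral_weight.simps)
  have inverse: "act (K i * Kinv i - 1) v \<in> N" "act (Kinv i * K i - 1) v \<in> N" if "i \<in> {1..m+n}" for i
    using toral_op_inverse[OF that]
    by (simp_all add: act_diff act_mult act_toral act_one cong_span_def[symmetric] del: toral_weight.simps)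
  show ?thesis using assms commute inverse unfolding R1_def by blast
qed

lemma act_R2:
  assumes "r \<in> R2 m n"
  shows "act r v \<in> N"
proof -
  have E: "act (K i * E j * Kinv i - (qi m i powi (of_bool (i = j) - of_bool (i = j + 1))) \<cdot>\<^sub>f E j) v \<in> N"
    if "i \<in> {1..m+n}" for i j
  proof -
    let ?w = "toral_weight m (gK i) j" and ?x = "toral_op (toral_weight m (gKinv i)) (Kinv i) v"
    have "cong_N (toral_op (toral_weight m (gK i)) (K i) (E_op j ?x))
        (left (const ?w) * E_op j (toral_op (toral_weight m (gK i)) (K i) ?x))"
      by (rule toral_op_E_op[OF toral_K[OF that]])
    moreover have "cong_N (left (const ?w) * E_op j (toral_op (toral_weight m (gK i)) (K i) ?x))
        (left (const ?w) * E_op j v)"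
      by (rule cong_N_left[OF cong_N_E_op[OF toral_op_inverse(1)[OF that]]])
    ultimately have "cong_N (toral_op (toral_weight m (gK i)) (K i) (E_op j ?x)) (left (const ?w) * E_op j v)"
      by (rule cong_span_trans)
    then show ?thesis
      by (simp only: act_diff act_mult act_toral act_scale cong_span_def toral_weight.simps)
  qed
  have F: "act (K i * F j * Kinv i - (qi m i powi (- (of_bool (i = j) - of_bool (i = j + 1)))) \<cdot>\<^sub>f F j) v \<in> N"
    if "i \<in> {1..m+n}" for i j
  proof -
    let ?w = "inverse (toral_weight m (gK i) j)"
    have "cong_N (left (const ?w) * (left (gen j) * toral_op (toral_weight m (gK i)) (K i)
          (toral_op (toral_weight m (gKinv i)) (Kinv i) v))) (left (const ?w) * (left (gen j) * v))"
      by (intro cong_N_left toral_op_inverse that)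
    then have "cong_N (toral_op (toral_weight m (gK i)) (K i) (left (gen j) *
          toral_op (toral_weight m (gKinv i)) (Kinv i) v)) (left (const ?w) * (left (gen j) * v))"
      by (simp add: toral_op_left twist_simps scale_def left_mult mult.assoc del: toral_weight.simps)
    then show ?thesis
      by (simp only: act_diff act_mult act_toral act_scale cong_span_def toral_weight.simps power_int_minus)
  qed
  show ?thesis using assms E F unfolding R2_def by blast
qed

lemma act_R3:
  assumes "r \<in> R3 m n"
  shows "act r v \<in> N"
proof -
  have "act (super_comm m (E i) (F j) - (of_bool (i = j) / (qi m i - inverse (qi m i))) \<cdot>\<^sub>f
         (K i * Kinv (i + 1) - Kinv i * K (i + 1))) v = 0"
    if "i \<in> {1..<m+n}" "j \<in> {1..<m+n}" for i j
  proof -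
    have "act (super_comm m (E i) (F j)) v = (if i = j then left (const (coroot_factor j)) *
        (toral_op (char_plus j) (toral_plus j) v - toral_op (char_minus j) (toral_minus j) v) else 0)"
      by (simp add: super_comm_gen act_diff act_mult act_scale act_toral E_op_F
          del: toral_weight.simps)
    moreover have "act (K i * Kinv (i + 1) - Kinv i * K (i + 1)) v =
        toral_op (char_plus i) (toral_plus i) v - toral_op (char_minus i) (toral_minus i) v"
      unfolding char_plus_def[abs_def] toral_plus_def char_minus_def[abs_def] toral_minus_def
      by (simp only: act_diff act_mult act_toral toral_op_toral_op)
    moreover have "of_bool (i = j) / (qi m i - inverse (qi m i)) = (if i = j then coroot_factor i else 0)"
      using that by (simp add: coroot_factor_def)
    ultimately show ?thesis
      by (simp only: act_diff act_scale) (auto simp: additive.zero[OF additive_left])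
  qed
  then show ?thesis using assms additive_span.zero unfolding R3_def by fastforce
qed

lemma act_Uq_rels:
  assumes "r \<in> Uq_rels m n"
  shows "act r v \<in> N"
  using Uq_rels_serre[OF assms] act_R1 act_R2 act_R3 act_E_J[OF ideal_span_superset]
    N_J[OF ideal_span_superset] act_F_hom by fastforce

lemma act_Uq_ideal:
  assumes "x \<in> ideal_span (Uq_rels m n)"
  shows "act x v \<in> N"
  using additive_act _ assms
proof (rule additive_span_image)
  show "act x v \<in> N" if "x \<in> multiples (Uq_rels m n)" for x
    using that by (elim multiplesE) (simp add: act_mult N_act act_Uq_rels)
qed

subsection \<open>Projection onto the even part\<close>

definition proj :: "('f poly fract, nat, qgen) tensor \<Rightarrow> 'f qfree" where
  "proj = contract (lift even_F)"

lemma additive_proj: "additive proj"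
  unfolding proj_def by (rule additive_contract)

lemma proj_tensor: "proj (left f * const a) = lift even_F f * a"
  unfolding proj_def by (rule contract_tensor) (simp add: linear_map_def additive_lift lift_scale)

lemma proj_left: "proj (left f * x) = lift even_F f * proj x"
proof (induction x rule: tensor_induct)
  case (tensor g a)
  then show ?case
    using proj_tensor[of "f * g" a] by (simp add: proj_tensor left_mult lift_mult mult.assoc)
qed (simp add: distrib_left additive.add[OF additive_proj])

lemma proj_N: "x \<in> N \<Longrightarrow> proj x \<in> ideal_span rels0"
proof (erule N_image[OF additive_proj, rotated 2])
  show "proj (left j * x) \<in> ideal_span rels0" if "j \<in> J" for j x
    unfolding proj_left using that by (intro ideal_span_mult_right lift_even_F_J)
  show "proj (left f * const a) \<in> ideal_span rels0" if "a \<in> ideal_span rels0" for f a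
    unfolding proj_tensor using that by (rule ideal_span_mult_left)
qed

lemma toral_lift_even_F:
  assumes "toral c t"
  shows "cong_ideal rels0 (t * lift even_F f) (lift even_F (twist (\<lambda>l. inverse (c l)) f) * t)"
proof (induction f rule: free_induct)
  case (const k)
  show ?case by (simp add: lift_simps twist_simps const_central)
next
  case (gen j f)
  let ?tw = "twist (\<lambda>l. inverse (c l))"
  have "cong_ideal rels0 (t * even_F j * lift even_F f) (inverse (c j) \<cdot>\<^sub>f (even_F j * t) * lift even_F f)"
    using assms by (intro cong_ideal_mult) (auto simp: toral_def)
  moreover have "cong_ideal rels0 (inverse (c j) \<cdot>\<^sub>f even_F j * (t * lift even_F f))
      (inverse (c j) \<cdot>\<^sub>f even_F j * (lift even_F (?tw f) * t))"
    by (intro cong_ideal_mult gen cong_span_refl)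
  ultimately show ?case
    using cong_span_trans by (fastforce simp: lift_simps twist_simps mult.assoc)
next
  case (add f g)
  then show ?case by (simp add: lift_simps twist_simps distrib_left distrib_right cong_span_add)
qed

text \<open>The restriction \<open>i \<noteq> m\<close> is what avoids the obstruction to a
  retraction: for \<open>i = j = m\<close> the even letters are 0, whereas the toral difference is
  not.\<close>

lemma rels0_E_F:
  assumes "i \<in> {1..<m+n}" and "i \<noteq> m"
  shows "cong_ideal rels0 (even_E i * even_F j)
    (even_F j * even_E i + (if j = i then coroot_factor i \<cdot>\<^sub>f (toral_plus i - toral_minus i) else 0))"
proof (cases "j \<in> {1..<m+n} \<and> j \<noteq> m")
  case False
  then have "even_F j = 0" "j \<noteq> i" using assms by (auto simp: even_F_def)
  then show ?thesis by simp
next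
  case True
  have 1: "super_comm m (E i) (F j) - (of_bool (i = j) / (qi m i - inverse (qi m i))) \<cdot>\<^sub>f
         (K i * Kinv (i + 1) - Kinv i * K (i + 1)) \<in> (R3 m n :: 'f qfree set)"
    unfolding R3_def using assms True by blast
  have "super_comm m (E i) (F j) = E i * F j - F j * (E i :: 'f qfree)"
    using assms by (simp add: super_comm_gen parity_def)
  then have 2: "super_comm m (E i) (F j) - (of_bool (i = j) / (qi m i - inverse (qi m i))) \<cdot>\<^sub>f
         (K i * Kinv (i + 1) - Kinv i * K (i + 1)) = even_E i * even_F j -
     (even_F j * even_E i + (if j = i then coroot_factor i \<cdot>\<^sub>f (toral_plus i - toral_minus i) else 0))"
    using assms True
    by (auto simp: even_E_def even_F_def toral_plus_def toral_minus_def coroot_factor_def)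
  have 3: "even_E i * even_F j -
     (even_F j * even_E i + (if j = i then coroot_factor i \<cdot>\<^sub>f (toral_plus i - toral_minus i) else 0))
      \<in> carrier (free_alg (even_qgens m n))"
    using assms True
    by (simp add: even_E_def even_F_def toral_plus_def toral_minus_def free_alg_closed even_qgens_simps)
  show ?thesis
    unfolding cong_span_def by (rule rels0_memI[OF disjI1 3]) (use 1 in \<open>simp only: 2\<close>)
qed

text \<open>The even algebra moves E_i past the image of \<open>f\<close> by the very formula that
  defines \<open>E_op i\<close>; hence the projection intertwines the two.\<close>

lemma even_E_lift_even_F:
  assumes i: "i \<in> {1..<m+n}" "i \<noteq> m"
  shows "cong_ideal rels0 (even_E i * lift even_F f) (lift even_F (twist (parity m i) f) * even_E i
     + (lift even_F (lowering i (char_minus i) f) * toral_plus i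
        - lift even_F (lowering i (char_plus i) f) * toral_minus i))"
proof (induction f rule: free_induct)
  case (const k)
  show ?case by (simp add: lift_simps twist_simps lowering_const const_central)
next
  case (gen j f)
  let ?L = "lift even_F"
  have par: "parity m i l = (1 :: 'f poly fract)" for l using i by (simp add: parity_def)
  have 1: "cong_ideal rels0 (even_E i * even_F j * ?L f) ((even_F j * even_E i
      + (if j = i then coroot_factor i \<cdot>\<^sub>f (toral_plus i - toral_minus i) else 0)) * ?L f)"
    by (intro cong_ideal_mult rels0_E_F i cong_span_refl)
  have plus: "cong_ideal rels0 (toral_plus i * ?L f) (?L (twist (char_minus i) f) * toral_plus i)"
    using toral_lift_even_F[OF toral_plus[OF i(1)]] by (simp add: char_minus)
  have minus: "cong_ideal rels0 (toral_minus i * ?L f) (?L (twist (char_plus i) f) * toral_minus i)"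
    using toral_lift_even_F[OF toral_minus[OF i(1)]] by (simp add: char_minus)
  have 2: "cong_ideal rels0 (even_F j * (even_E i * ?L f)
      + (if j = i then coroot_factor i \<cdot>\<^sub>f (toral_plus i * ?L f - toral_minus i * ?L f) else 0))
     (even_F j * (?L (twist (parity m i) f) * even_E i
       + (?L (lowering i (char_minus i) f) * toral_plus i - ?L (lowering i (char_plus i) f) * toral_minus i))
      + (if j = i then coroot_factor i \<cdot>\<^sub>f (?L (twist (char_minus i) f) * toral_plus i
          - ?L (twist (char_plus i) f) * toral_minus i) else 0))"
    by (rule cong_span_add[OF cong_ideal_mult[OF cong_span_refl gen]])
      (auto intro: cong_ideal_scale[OF cong_span_diff[OF plus minus]])
  have 3: "(even_F j * even_E i
      + (if j = i then coroot_factor i \<cdot>\<^sub>f (toral_plus i - toral_minus i) else 0)) * ?L f =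
     even_F j * (even_E i * ?L f)
      + (if j = i then coroot_factor i \<cdot>\<^sub>f (toral_plus i * ?L f - toral_minus i * ?L f) else 0)"
    by (simp add: distrib_right left_diff_distrib mult.assoc)
  have 4: "?L (twist (parity m i) (gen j * f)) * even_E i
     + (?L (lowering i (char_minus i) (gen j * f)) * toral_plus i
        - ?L (lowering i (char_plus i) (gen j * f)) * toral_minus i) =
     even_F j * (?L (twist (parity m i) f) * even_E i
       + (?L (lowering i (char_minus i) f) * toral_plus i - ?L (lowering i (char_plus i) f) * toral_minus i))
      + (if j = i then coroot_factor i \<cdot>\<^sub>f (?L (twist (char_minus i) f) * toral_plus i
          - ?L (twist (char_plus i) f) * toral_minus i) else 0)"
    by (simp add: twist_simps lift_simps lowering_gen_mult par scale_distrib algebra_simps)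
  have 5: "even_E i * ?L (gen j * f) = even_E i * even_F j * ?L f"
    by (simp add: lift_simps mult.assoc)
  show ?case unfolding 4 5 by (rule cong_span_trans[OF 1[unfolded 3] 2])
next
  case (add f g)
  have 1: "(a + a') * b + ((c + c') * d - (e + e') * k) = (a * b + (c * d - e * k)) + (a' * b + (c' * d - e' * k))"
    for a a' b c c' d e e' k :: "'f qfree"
    by (simp add: algebra_simps)
  show ?case
    unfolding twist_simps lift_add lowering_add distrib_left 1 by (rule cong_span_add[OF add])
qed

text \<open>Apart from the F letters, which act by plain left multiplication, each case is the
  exchange rule of \<open>g\<close> with the image of the left tensor factor, read
  backwards.\<close>

lemma proj_gen_op:
  assumes "g \<in> even_qgens m n"
  shows "cong_ideal rels0 (proj (gen_op g x)) (gen g * proj x)"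
proof (induction x rule: tensor_induct)
  case (tensor f a)
  have toral: "cong_ideal rels0 (proj (toral_op c t (left f * const a))) (t * proj (left f * const a))"
    if "toral c t" for c t
    using cong_ideal_mult[OF cong_span_sym[OF toral_lift_even_F[OF that]] cong_span_refl[of _ a]]
    by (simp add: toral_op_tensor proj_tensor mult.assoc)
  show ?case
  proof (cases g)
    case (gE i)
    then have i: "i \<in> {1..<m+n}" "i \<noteq> m" using assms by (auto simp: even_qgens_simps)
    then have "E i = even_E i" by (simp add: even_E_def)
    then show ?thesis
      using cong_ideal_mult[OF cong_span_sym[OF even_E_lift_even_F[OF i]] cong_span_refl[of _ a]]
      by (simp add: gE E_op_tensor proj_tensor additive.add[OF additive_proj]
          additive.diff[OF additive_proj] distrib_right left_diff_distrib mult.assoc)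
  next
    case (gF i)
    then have "i \<in> {1..<m+n}" "i \<noteq> m" using assms by (auto simp: even_qgens_simps)
    then have "F i = even_F i" by (simp add: even_F_def)
    then show ?thesis by (simp add: gF proj_left lift_gen)
  next
    case (gK i)
    then show ?thesis using assms toral[OF toral_K] by (simp add: even_qgens_simps)
  next
    case (gKinv i)
    then show ?thesis using assms toral[OF toral_Kinv] by (simp add: even_qgens_simps)
  qed
next
  case (add x y)
  then show ?case
    by (simp add: additive.add[OF additive_gen_op] additive.add[OF additive_proj] distrib_left cong_span_add)
qed

text \<open>With \<open>restrict_gens\<close> the induction can run over all letters; those outside
  the even part give 0 on both sides.\<close>

lemma proj_act: "cong_ideal rels0 (proj (act (restrict_gens (even_qgens m n) x) 1)) (restrict_gens (even_qgens m n) x)"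
proof (induction x rule: free_induct)
  case (const c)
  show ?case
    using proj_tensor[of "const c" 1] by (simp add: restrict_gens_simps lift_const act_const)
next
  case (gen g x)
  show ?case
  proof (cases "g \<in> even_qgens m n")
    case True
    have "cong_ideal rels0 (proj (gen_op g (act (restrict_gens (even_qgens m n) x) 1))) (gen g * proj (act (restrict_gens (even_qgens m n) x) 1))"
      by (rule proj_gen_op[OF True])
    moreover have "cong_ideal rels0 (gen g * proj (act (restrict_gens (even_qgens m n) x) 1)) (gen g * restrict_gens (even_qgens m n) x)"
      by (intro cong_ideal_mult gen cong_span_refl)
    ultimately show ?thesis
      using True cong_span_trans by (fastforce simp: restrict_gens_simps act_gen_mult)
  next
    case False
    then show ?thesis
      by (simp add: restrict_gens_simps additive.zero[OF additive_act] additive.zero[OF additive_proj])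
  qed
next
  case (add x y)
  then show ?case
    by (simp add: restrict_gens_simps act_add additive.add[OF additive_proj] cong_span_add)
qed

text \<open>Injectivity of the canonical homomorphism: the projection of \<open>x \<cdot> (1 \<otimes> 1)\<close> recovers \<open>x\<close>.\<close>

lemma even_Uq_ideal:
  assumes "x \<in> ideal_span (Uq_rels m n)" and "x \<in> carrier (free_alg (even_qgens m n))"
  shows "x \<in> ideal_span rels0"
  using proj_act[of x] proj_N[OF act_Uq_ideal[OF assms(1), of 1]]
  unfolding restrict_gens_id[OF assms(2)]
  using cong_span_sym cong_span_mem by blast

section \<open>Relations as elements of the right free algebras\<close>

lemma serre_closed: "r \<in> serre m n \<Longrightarrow> (r :: 'f lfree) \<in> carrier (free_alg {1..<m+n})"
proof (induction rule: serre.induct)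
  case odd
  then have "m - 1 \<in> {1..<m+n}" "m \<in> {1..<m+n}" "m + 1 \<in> {1..<m+n}" by auto
  then show ?case by (simp only: odd_serre_def Let_def free_alg_closed)
qed (use m_pos n_pos in \<open>simp_all add: free_alg_closed\<close>)

text \<open>Goes through \<open>Uq_rels_serre\<close>, so that (R8) is treated via Serre elements
  instead of recursive root vectors.\<close>

lemma Uq_rels_closed: "Uq_rels m n \<subseteq> (carrier (free_alg (qgens m n)) :: 'f qfree set)"
proof
  fix r :: "'f qfree" assume "r \<in> Uq_rels m n"
  then consider "r \<in> R1 m n" | "r \<in> R2 m n" | "r \<in> R3 m n" | "r \<in> E_hom ` serre m n" | "r \<in> F_hom ` serre m n"
    using Uq_rels_serre by blast
  then show "r \<in> carrier (free_alg (qgens m n))"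
  proof cases
    case 1
    then show ?thesis unfolding R1_def by (auto simp: free_alg_closed qgens_def)
  next
    case 2
    then show ?thesis unfolding R2_def by (auto intro!: free_alg_closed simp: free_alg_closed(1) qgens_def)
  next
    case 3
    then show ?thesis
      unfolding R3_def by (auto intro!: free_alg_closed simp: super_comm_gen free_alg_closed(1) qgens_def)
  next
    case 4
    then show ?thesis by (auto intro!: lift_closed[OF serre_closed] simp: free_alg_closed qgens_def)
  next
    case 5
    then show ?thesis by (auto intro!: lift_closed[OF serre_closed] simp: free_alg_closed qgens_def)
  qed
qed

end

theorem theorem5p5:
  fixes m n :: nat
  assumes "m \<ge> 1" and "n \<ge> 1"
  shows "\<exists>\<phi> \<in> alg_iso (Uq0 m n :: 'f::field_char_0 qalg) (Uq0_dot m n :: 'f qalg).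
           \<forall>g \<in> even_qgens m n. \<phi> (Uq0_gen m n g) = Uq_gen m n g"
proof -
  interpret quantum_gl m n "TYPE('f)" using assms by unfold_locales
  show ?thesis
    unfolding Uq0_def Uq0_dot_def Uq0_gen_def Uq_gen_def Uq_def
  proof (rule presented_subalgebra)
    show "Uq_rels m n \<subseteq> (carrier (free_alg (qgens m n)) :: 'f qfree set)" by (rule Uq_rels_closed)
    show "x \<in> ideal_span rels0"
      if "x \<in> carrier (free_alg (even_qgens m n))" "x \<in> ideal_span (Uq_rels m n)" for x
      using that by (intro even_Uq_ideal)
  qed (auto simp: even_qgens_def Uq0_rels_def Uq_rels_def)
qed

end
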